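(* Let $f$ be a cuspidal edge at $\mathbf{0}\in\mathbf{R}^2$ given in the normal form $$f(u,v)=\Big(u,\ \tfrac{a_{20}}{2}u^2+\tfrac{a_{30}}{6}u^3+\tfrac{v^2}{2},\ \tfrac{b_{20}}{2}u^2+\tfrac{b_{30}}{6}u^3+\tfrac{b_{12}}{2}uv^2+\tfrac{b_{03}}{6}v^3\Big)+h(u,v)$$ (see the context), with $b_{20}\neq 0$. Put $t_0=1/\hat\kappa_2(\mathbf 0)=1/b_{20}$, $q=f(\mathbf 0)+t_0\nu(\mathbf 0)$, and $$\varphi(u,v)=-\tfrac12\big(\|q-f(u,v)\|^2-t_0^2\big).$$ Then the function $\varphi$ has a $D_4$ singularity at $\mathbf 0$ if and only if $b_{30}\neq0$ and $\mathbf 0$ is not a ridge point of $f$.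
   Context: All maps are $C^\infty$. In the normal form, $a_{ij},b_{ij}$ are real constants with $b_{20}\ge0$, $b_{03}\neq0$, and $h(u,v)=(0,\,u^4h_1(u),\,u^4h_2(u)+u^2v^2h_3(u)+uv^3h_4(u)+v^4h_5(u,v))$ with $h_1,\dots,h_5$ smooth functions; $f$ is considered on a small neighborhood $U$ of $\mathbf 0$, where the singular set of $f$ is the $u$-axis. Write $f_v=v\psi$ with $\psi$ smooth and nowhere zero; $f_u,\psi$ are linearly independent and $\nu=f_u\times\psi/\|f_u\times\psi\|$ is the unit normal. Set $\hat E=\langle f_u,f_u\rangle$, $\hat F=\langle f_u,\psi\rangle$, $\hat G=\langle\psi,\psi\rangle$, $\hat L=-\langle f_u,\nu_u\rangle$, $\hat M=-\langle\psi,\nu_u\rangle$, $\hat N=-\langle\psi,\nu_v\rangle$, $\hat A=\hat E\hat N-2v\hat F\hat M+v\hat G\hat L$, $\hat B=\sqrt{\hat A^2-4v(\hat E\hat G-\hat F^2)(\hat L\hat N-v\hat M^2)}$ and $$\hat\kappa_2=\frac{\hat A-\hat B}{2v(\hat E\hat G-\hat F^2)}\quad(v\neq0).$$ Standing assumption: $\hat N>0$ on the $u$-axis (at the origin $\hat N(\mathbf 0)=b_{03}/2$, so $b_{03}>0$); then $\hat\kappa_2$ extends smoothly across the $u$-axis near $\mathbf 0$, and $\hat\kappa_2(\mathbf 0)=b_{20}$. The principal direction is $\hat{\boldsymbol v}=\xi\partial_u+\zeta\partial_v$ with $(\xi,\zeta)=(\hat N-v\hat\kappa_2\hat G,\,-\hat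 M+\hat\kappa_2\hat F)$. The point $\mathbf 0$ is a ridge point of $f$ if the directional derivative $\hat{\boldsymbol v}\hat\kappa_2$ vanishes at $\mathbf 0$. Function-germs $k_1,k_2:(\mathbf{R}^2,\mathbf 0)\to(\mathbf{R},0)$ are right equivalent if $k_2=k_1\circ\theta$ for a diffeomorphism-germ $\theta$ of $(\mathbf{R}^2,\mathbf 0)$. A function-germ has a $D_4$ singularity at $\mathbf 0$ if it is right equivalent to $u^3+uv^2$ or to $u^3-uv^2$ at $\mathbf 0$. *)

theory Defs
  imports "HOL-Analysis.Analysis"
begin

text \<open>Only meaningful for open \<open>S\<close>. Quantifying over all fixed directions \<open>w\<close> amounts to
  the existence and continuity of all iterated partial derivatives.\<close>

primrec Ck_on :: "nat \<Rightarrow> 'a::real_normed_vector set \<Rightarrow> ('a \<Rightarrow> 'b::real_normed_vector) \<Rightarrow> bool" where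
  "Ck_on 0 S f \<longleftrightarrow> continuous_on S f"
| "Ck_on (Suc n) S f \<longleftrightarrow>
     (\<forall>x\<in>S. f differentiable (at x)) \<and> (\<forall>w. Ck_on n S (\<lambda>x. frechet_derivative f (at x) w))"

definition smooth_on :: "'a::real_normed_vector set \<Rightarrow> ('a \<Rightarrow> 'b::real_normed_vector) \<Rightarrow> bool" where
  "smooth_on S f \<longleftrightarrow> (\<forall>n. Ck_on n S f)"

definition smooth_near :: "'a::real_normed_vector \<Rightarrow> ('a \<Rightarrow> 'b::real_normed_vector) \<Rightarrow> bool" where
  "smooth_near x f \<longleftrightarrow> (\<exists>U. open U \<and> x \<in> U \<and> smooth_on U f)"


text \<open>Germs at \<open>0\<close> are represented by total functions; only values near \<open>0\<close> matter.\<close>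

definition right_equivalent :: "(real \<times> real \<Rightarrow> real) \<Rightarrow> (real \<times> real \<Rightarrow> real) \<Rightarrow> bool" where
  "right_equivalent k1 k2 \<longleftrightarrow>
     (\<exists>U V \<theta> \<theta>'. open U \<and> 0 \<in> U \<and> open V \<and> 0 \<in> V \<and> homeomorphism U V \<theta> \<theta>' \<and>
        smooth_on U \<theta> \<and> smooth_on V \<theta>' \<and> \<theta> 0 = 0 \<and> (\<forall>p\<in>U. k2 p = k1 (\<theta> p)))"

definition has_D4_singularity :: "(real \<times> real \<Rightarrow> real) \<Rightarrow> bool" where
  "has_D4_singularity k \<longleftrightarrow>
     right_equivalent k (\<lambda>(u, v). u ^ 3 + u * v\<^sup>2) \<or>
     right_equivalent k (\<lambda>(u, v). u ^ 3 - u * v\<^sup>2)"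


definition D_u :: "(real \<times> real \<Rightarrow> 'b::real_normed_vector) \<Rightarrow> real \<times> real \<Rightarrow> 'b" where
  "D_u g p = frechet_derivative g (at p) (1, 0)"

definition D_v :: "(real \<times> real \<Rightarrow> 'b::real_normed_vector) \<Rightarrow> real \<times> real \<Rightarrow> 'b" where
  "D_v g p = frechet_derivative g (at p) (0, 1)"

text \<open>The value of \<open>g\<close> off the \<open>u\<close>-axis, continued to the axis by taking limits. If \<open>g\<close> has a
  smooth (or just continuous) extension across the axis, this is that extension.\<close>

definition axis_extension :: "(real \<times> real \<Rightarrow> 'b::t2_space) \<Rightarrow> real \<times> real \<Rightarrow> 'b" where
  "axis_extension g p = (if snd p \<noteq> 0 then g p else Lim (at p within {q. snd q \<noteq> 0}) g)"

text \<open>In what follows \<open>f\<close> is a front with \<open>f\<^sub>v = v \<psi>\<close>, \<open>\<psi>\<close> smooth.\<close>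

definition psi :: "(real \<times> real \<Rightarrow> real^3) \<Rightarrow> real \<times> real \<Rightarrow> real^3" where
  "psi f = axis_extension (\<lambda>p. D_v f p /\<^sub>R snd p)"

definition unit_normal :: "(real \<times> real \<Rightarrow> real^3) \<Rightarrow> real \<times> real \<Rightarrow> real^3" where
  "unit_normal f p = cross3 (D_u f p) (psi f p) /\<^sub>R norm (cross3 (D_u f p) (psi f p))"

definition E_hat :: "(real \<times> real \<Rightarrow> real^3) \<Rightarrow> real \<times> real \<Rightarrow> real" where
  "E_hat f p = D_u f p \<bullet> D_u f p"

definition F_hat :: "(real \<times> real \<Rightarrow> real^3) \<Rightarrow> real \<times> real \<Rightarrow> real" where
  "F_hat f p = D_u f p \<bullet> psi f p"

definition G_hat :: "(real \<times> real \<Rightarrow> real^3) \<Rightarrow> real \<times> real \<Rightarrow> real" where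
  "G_hat f p = psi f p \<bullet> psi f p"

definition L_hat :: "(real \<times> real \<Rightarrow> real^3) \<Rightarrow> real \<times> real \<Rightarrow> real" where
  "L_hat f p = - (D_u f p \<bullet> D_u (unit_normal f) p)"

definition M_hat :: "(real \<times> real \<Rightarrow> real^3) \<Rightarrow> real \<times> real \<Rightarrow> real" where
  "M_hat f p = - (psi f p \<bullet> D_u (unit_normal f) p)"

definition N_hat :: "(real \<times> real \<Rightarrow> real^3) \<Rightarrow> real \<times> real \<Rightarrow> real" where
  "N_hat f p = - (psi f p \<bullet> D_v (unit_normal f) p)"

definition A_hat :: "(real \<times> real \<Rightarrow> real^3) \<Rightarrow> real \<times> real \<Rightarrow> real" where
  "A_hat f p = E_hat f p * N_hat f p - 2 * snd p * F_hat f p * M_hat f p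
     + snd p * G_hat f p * L_hat f p"

definition B_hat :: "(real \<times> real \<Rightarrow> real^3) \<Rightarrow> real \<times> real \<Rightarrow> real" where
  "B_hat f p = sqrt ((A_hat f p)\<^sup>2
     - 4 * snd p * (E_hat f p * G_hat f p - (F_hat f p)\<^sup>2)
         * (L_hat f p * N_hat f p - snd p * (M_hat f p)\<^sup>2))"

definition kappa2_hat :: "(real \<times> real \<Rightarrow> real^3) \<Rightarrow> real \<times> real \<Rightarrow> real" where
  "kappa2_hat f = axis_extension (\<lambda>p. (A_hat f p - B_hat f p)
     / (2 * snd p * (E_hat f p * G_hat f p - (F_hat f p)\<^sup>2)))"

definition principal_direction :: "(real \<times> real \<Rightarrow> real^3) \<Rightarrow> real \<times> real \<Rightarrow> real \<times> real" where
  "principal_direction f p =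
     (N_hat f p - snd p * kappa2_hat f p * G_hat f p, - M_hat f p + kappa2_hat f p * F_hat f p)"

definition ridge_point :: "(real \<times> real \<Rightarrow> real^3) \<Rightarrow> real \<times> real \<Rightarrow> bool" where
  "ridge_point f p \<longleftrightarrow>
     frechet_derivative (kappa2_hat f) (at p) (principal_direction f p) = 0"

end

theory Submission
  imports Defs
begin

text \<open>Since \<open>\<nu>(0) = (0, 0, 1)\<close> and \<open>t\<^sub>0 = 1 / b\<^sub>2\<^sub>0\<close>, the distance-squared function is
\<open>\<phi> = t\<^sub>0 f\<^sub>3 - \<parallel>f\<parallel>\<^sup>2 / 2\<close>. The choice of \<open>t\<^sub>0\<close> cancels the quadratic terms, and the shape of the normal
form (no \<open>u\<^sup>2 v\<close> and no \<open>u\<^sup>3 v\<close> anywhere) lets one collect the remaining ones as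
\<open>\<phi> = a u\<^sup>3 + c u v\<^sup>2 + d v\<^sup>3\<close> with smooth functions \<open>a\<close>, \<open>c\<close>, \<open>d\<close> whose values at \<open>0\<close> are
\<open>t\<^sub>0 b\<^sub>3\<^sub>0 / 6\<close>, \<open>t\<^sub>0 b\<^sub>1\<^sub>2 / 2\<close> and \<open>t\<^sub>0 b\<^sub>0\<^sub>3 / 6\<close>.

Such a function has a \<open>D\<^sub>4\<close> singularity exactly when the binary cubic formed by the values of the
coefficients at \<open>0\<close> has nonzero discriminant (theorem \<open>has_D4_singularity_iff\<close>). If the
discriminant vanishes, the cubic has a critical point other than \<open>0\<close>; a diffeomorphism
to \<open>u\<^sup>3 \<plusminus> u v\<^sup>2\<close> would carry it, through its derivative at \<open>0\<close>, to a nonzero critical point of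
\<open>u\<^sup>3 \<plusminus> u v\<^sup>2\<close>, and there is none. Conversely, the cubic can be normalised pointwise, by linear algebra
with smooth coefficients: a simple real root of \<open>a s\<^sup>3 + c s + d\<close> is a smooth function of the base
point by the implicit function theorem, so the cubic form splits into a linear and a quadratic
factor; completing the square and rescaling with roots of nonvanishing functions turns it into
\<open>x\<^sup>3 \<plusminus> x y\<^sup>2\<close>. The new coordinates \<open>x\<close>, \<open>y\<close> are linear in \<open>u\<close>, \<open>v\<close> with smooth coefficients, hence a local
diffeomorphism. The higher order terms of the function sit inside the coefficients from the start and
are normalised along with the leading ones.

It remains to recognise the second factor of the discriminant, \<open>4 b\<^sub>1\<^sub>2\<^sup>3 + b\<^sub>3\<^sub>0 b\<^sub>0\<^sub>3\<^sup>2\<close>, as the obstruction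
to a ridge point (theorem \<open>ridge_point_iff\<close>). Off the \<open>u\<close>-axis \<open>\<kappa>\<^sub>2\<close> is a root of
\<open>v (E G - F\<^sup>2) \<kappa>\<^sup>2 - A \<kappa> + (L N - v M\<^sup>2) = 0\<close>, and multiplying by the conjugate expression writes it in a
form that is smooth across the axis. Differentiating the equation at \<open>0\<close>, instead of the
root, gives \<open>N d\<kappa> = N dL - M\<^sup>2 dv\<close>; along the principal direction \<open>(N, - M)\<close> the derivative of the normal
drops out of \<open>dL\<close> and only \<open>b\<^sub>3\<^sub>0 N\<^sup>2 + M\<^sup>3\<close> is left, where \<open>N = b\<^sub>0\<^sub>3 / 2\<close> and \<open>M = b\<^sub>1\<^sub>2\<close>.\<close>

section \<open>Calculus of smooth maps\<close>

lemma Ck_on_cong: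
  assumes "open S" "\<And>x. x \<in> S \<Longrightarrow> f x = g x"
  shows "Ck_on n S f \<longleftrightarrow> Ck_on n S g"
  using assms(2)
proof (induction n arbitrary: f g)
  case 0
  then show ?case by (simp cong: continuous_on_cong)
next
  case (Suc n)
  have hd: "(f has_derivative D) (at x) \<longleftrightarrow> (g has_derivative D) (at x)" if "x \<in> S" for x D
    using has_derivative_transform_within_open[OF _ assms(1) that, of f D UNIV g]
      has_derivative_transform_within_open[OF _ assms(1) that, of g D UNIV f] Suc.prems by auto
  have 1: "f differentiable (at x) \<longleftrightarrow> g differentiable (at x)"
    and 2: "frechet_derivative f (at x) = frechet_derivative g (at x)" if "x \<in> S" for x
    using hd[OF that] by (auto simp: differentiable_def frechet_derivative_def)
  have "Ck_on n S (\<lambda>x. frechet_derivative f (at x) w) \<longleftrightarrow>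
      Ck_on n S (\<lambda>x. frechet_derivative g (at x) w)" for w
    by (rule Suc.IH) (simp add: 2)
  with 1 show ?case by simp
qed

text \<open>The derivative in \<^const>\<open>Ck_on\<close> is chosen by a description operator; this rule allows any
formula for it, and the inductions behind the closure properties below rest on it.\<close>

lemma Ck_on_SucI:
  assumes "open S" "\<And>x. x \<in> S \<Longrightarrow> (f has_derivative f' x) (at x)"
    and "\<And>w. Ck_on n S (\<lambda>x. f' x w)"
  shows "Ck_on (Suc n) S f"
proof -
  have "Ck_on n S (\<lambda>x. frechet_derivative f (at x) w)" for w
    using assms(3)[of w] frechet_derivative_at[OF assms(2)]
    by (subst Ck_on_cong[OF assms(1), of _ "\<lambda>x. f' x w"]) auto
  then show ?thesis using assms(2) by (auto simp: differentiable_def)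
qed

lemma Ck_on_Suc_has_derivative:
  "Ck_on (Suc n) S f \<Longrightarrow> x \<in> S \<Longrightarrow> (f has_derivative frechet_derivative f (at x)) (at x)"
  by (simp add: frechet_derivative_works)

lemma Ck_on_SucD: "Ck_on (Suc n) S f \<Longrightarrow> Ck_on n S f"
proof (induction n arbitrary: f)
  case 0
  then have "\<forall>x\<in>S. isCont f x" by (simp add: differentiable_imp_continuous_within)
  then show ?case by (simp add: continuous_at_imp_continuous_on)
next
  case (Suc n)
  then show ?case by (metis Ck_on.simps(2))
qed

lemma Ck_on_subset: "Ck_on n S f \<Longrightarrow> T \<subseteq> S \<Longrightarrow> Ck_on n T f"
  by (induction n arbitrary: f) (simp_all add: continuous_on_subset subset_iff)

lemma Ck_on_const: "open S \<Longrightarrow> Ck_on n S (\<lambda>x. c)"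
  by (induction n arbitrary: c) simp_all

lemma Ck_on_id: "open S \<Longrightarrow> Ck_on n S (\<lambda>x. x)"
  by (cases n) (simp_all add: Ck_on_const)

lemma Ck_on_add:
  assumes "open S"
  shows "Ck_on n S f \<Longrightarrow> Ck_on n S g \<Longrightarrow> Ck_on n S (\<lambda>x. f x + g x)"
proof (induction n arbitrary: f g)
  case 0 then show ?case by (simp add: continuous_on_add)
next
  case (Suc n)
  show ?case
    by (rule Ck_on_SucI[OF assms has_derivative_add[OF Ck_on_Suc_has_derivative
          Ck_on_Suc_has_derivative]])
      (use Suc in auto)
qed

lemma Ck_on_sum:
  assumes "open S" "finite I" "\<And>i. i \<in> I \<Longrightarrow> Ck_on n S (f i)"
  shows "Ck_on n S (\<lambda>x. \<Sum>i\<in>I. f i x)"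
  using assms(2,3) by (induction I) (simp_all add: Ck_on_const Ck_on_add assms(1))

lemma Ck_on_bounded_linear:
  assumes "open S" "bounded_linear L"
  shows "Ck_on n S f \<Longrightarrow> Ck_on n S (\<lambda>x. L (f x))"
proof (induction n arbitrary: f)
  case 0 then show ?case by (simp add: bounded_linear.continuous_on[OF assms(2)])
next
  case (Suc n)
  show ?case
    by (rule Ck_on_SucI[OF assms(1) bounded_linear.has_derivative[OF assms(2)
          Ck_on_Suc_has_derivative]])
      (use Suc in auto)
qed

lemma Ck_on_bounded_bilinear:
  assumes "open S" "bounded_bilinear b"
  shows "Ck_on n S f \<Longrightarrow> Ck_on n S g \<Longrightarrow> Ck_on n S (\<lambda>x. b (f x) (g x))"
proof (induction n arbitrary: f g)
  case 0 then show ?case by (simp add: bounded_bilinear.continuous_on[OF assms(2)])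
next
  case (Suc n)
  note fg = Suc.prems[THEN Ck_on_SucD]
  show ?case
    by (rule Ck_on_SucI[OF assms(1) bounded_bilinear.FDERIV[OF assms(2)
          Ck_on_Suc_has_derivative Ck_on_Suc_has_derivative]])
      (use Suc fg in \<open>auto intro!: Ck_on_add assms(1)\<close>)
qed

text \<open>The chain rule expresses a directional derivative of \<open>g \<circ> f\<close> through those of \<open>g\<close> along a
  basis, which is why the middle space has to be finite-dimensional: \<^const>\<open>Ck_on\<close> speaks about
  fixed directions only.\<close>

lemma Ck_on_compose:
  fixes f :: "'a::real_normed_vector \<Rightarrow> 'b::euclidean_space"
    and g :: "'b \<Rightarrow> 'c::real_normed_vector"
  assumes "open S" "f ` S \<subseteq> T"
  shows "Ck_on n S f \<Longrightarrow> Ck_on n T g \<Longrightarrow> Ck_on n S (\<lambda>x. g (f x))"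
proof (induction n arbitrary: g)
  case 0 then show ?case using assms(2) by (auto intro: continuous_on_compose2)
next
  case (Suc n)
  let ?f' = "\<lambda>x. frechet_derivative f (at x)" and ?g' = "\<lambda>y. frechet_derivative g (at y)"
  have g': "(g has_derivative ?g' (f x)) (at (f x))" if "x \<in> S" for x
    using Suc.prems(2) assms(2) that by (intro Ck_on_Suc_has_derivative) auto
  have "((\<lambda>x. g (f x)) has_derivative (\<lambda>w. \<Sum>i\<in>Basis. (?f' x w \<bullet> i) *\<^sub>R ?g' (f x) i)) (at x)"
    if x: "x \<in> S" for x
  proof -
    have "((\<lambda>x. g (f x)) has_derivative (\<lambda>w. ?g' (f x) (?f' x w))) (at x)"
      by (rule has_derivative_compose[OF Ck_on_Suc_has_derivative[OF Suc.prems(1) x] g'[OF x]])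
    moreover have "?g' (f x) y = (\<Sum>i\<in>Basis. (y \<bullet> i) *\<^sub>R ?g' (f x) i)" for y
    proof -
      have "?g' (f x) (\<Sum>i\<in>Basis. (y \<bullet> i) *\<^sub>R i) = (\<Sum>i\<in>Basis. (y \<bullet> i) *\<^sub>R ?g' (f x) i)"
        using has_derivative_linear[OF g'[OF x]] by (simp add: linear_sum linear_scale)
      then show ?thesis by (simp only: euclidean_representation)
    qed
    ultimately show ?thesis by (elim has_derivative_eq_rhs) (rule ext)
  qed
  then show ?case
  proof (rule Ck_on_SucI[OF assms(1)])
    fix w
    have "Ck_on n S (\<lambda>x. ?g' (f x) i)" for i
      using Suc.prems Suc.IH[OF Ck_on_SucD[OF Suc.prems(1)], of "\<lambda>y. ?g' y i"] by simp
    then show "Ck_on n S (\<lambda>x. \<Sum>i\<in>Basis. (?f' x w \<bullet> i) *\<^sub>R ?g' (f x) i)"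
      using Suc.prems
      by (intro Ck_on_sum Ck_on_bounded_bilinear[OF _ bounded_bilinear_scaleR] assms(1) finite_Basis
          Ck_on_bounded_linear[OF _ bounded_linear_inner_left]) auto
  qed
qed

lemma Ck_on_inverse:
  fixes f :: "'a::real_normed_vector \<Rightarrow> real"
  assumes "open S" "\<And>x. x \<in> S \<Longrightarrow> f x \<noteq> 0"
  shows "Ck_on n S f \<Longrightarrow> Ck_on n S (\<lambda>x. inverse (f x))"
proof (induction n)
  case 0 then show ?case using assms(2) by (simp add: continuous_on_inverse)
next
  case (Suc n)
  note f = Ck_on_SucD[OF Suc.prems]
  show ?case
  proof (rule Ck_on_SucI[OF assms(1) Deriv.has_derivative_inverse[OF assms(2)
          Ck_on_Suc_has_derivative[OF Suc.prems]]])
    fix w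
    have "Ck_on n S (\<lambda>x. - (inverse (f x) * frechet_derivative f (at x) w * inverse (f x)))"
      using Suc f by (intro Ck_on_bounded_linear[OF _ bounded_linear_minus[OF bounded_linear_ident]]
          Ck_on_bounded_bilinear[OF _ bounded_bilinear_mult] assms(1)) auto
    then show "Ck_on n S (\<lambda>x. - (inverse (f x) * frechet_derivative f (at x) w * inverse (f x)))" .
  qed
qed

text \<open>The exponent has to vary in the induction, since differentiation lowers it by one.\<close>

lemma Ck_on_powr:
  fixes f :: "'a::real_normed_vector \<Rightarrow> real"
  assumes "open S" "\<And>x. x \<in> S \<Longrightarrow> f x > 0"
  shows "Ck_on n S f \<Longrightarrow> Ck_on n S (\<lambda>x. f x powr a)"
proof (induction n arbitrary: a)
  case 0 then show ?case
    using assms(2) by (force intro!: continuous_on_powr)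
next
  case (Suc n)
  note f = Ck_on_SucD[OF Suc.prems]
  show ?case
  proof (rule Ck_on_SucI[OF assms(1)])
    fix x assume x: "x \<in> S"
    show "((\<lambda>x. f x powr a) has_derivative
        (\<lambda>w. (a * f x powr (a - 1)) * frechet_derivative f (at x) w)) (at x)"
      by (rule DERIV_compose_FDERIV[OF has_real_derivative_powr[OF assms(2)[OF x]]
          Ck_on_Suc_has_derivative[OF Suc.prems x], THEN has_derivative_eq_rhs]) (auto simp: mult_ac)
  next
    fix w
    show "Ck_on n S (\<lambda>x. (a * f x powr (a - 1)) * frechet_derivative f (at x) w)"
      using Suc f
      by (intro Ck_on_bounded_bilinear[OF _ bounded_bilinear_mult] Ck_on_const assms(1)) auto
  qed
qed

lemma smooth_onD: "smooth_on S f \<Longrightarrow> Ck_on n S f"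
  by (simp add: smooth_on_def)

lemma smooth_on_cong:
  "open S \<Longrightarrow> (\<And>x. x \<in> S \<Longrightarrow> f x = g x) \<Longrightarrow> smooth_on S f \<longleftrightarrow> smooth_on S g"
  unfolding smooth_on_def using Ck_on_cong[of S f g] by simp

lemma smooth_on_subset: "smooth_on S f \<Longrightarrow> T \<subseteq> S \<Longrightarrow> smooth_on T f"
  unfolding smooth_on_def using Ck_on_subset by blast

lemma smooth_on_imp_continuous_on: "smooth_on S f \<Longrightarrow> continuous_on S f"
  using smooth_onD[of S f 0] by simp

lemma smooth_on_has_derivative:
  "smooth_on S f \<Longrightarrow> x \<in> S \<Longrightarrow> (f has_derivative frechet_derivative f (at x)) (at x)"
  by (rule Ck_on_Suc_has_derivative[OF smooth_onD[of S f "Suc 0"]])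

lemma smooth_on_frechet_derivative:
  "smooth_on S f \<Longrightarrow> smooth_on S (\<lambda>x. frechet_derivative f (at x) w)"
  unfolding smooth_on_def by (metis Ck_on.simps(2))

lemma smooth_on_const: "open S \<Longrightarrow> smooth_on S (\<lambda>x. c)"
  by (simp add: smooth_on_def Ck_on_const)

lemma smooth_on_id: "open S \<Longrightarrow> smooth_on S (\<lambda>x. x)"
  by (simp add: smooth_on_def Ck_on_id)

lemma smooth_on_add:
  "smooth_on S f \<Longrightarrow> smooth_on S g \<Longrightarrow> open S \<Longrightarrow> smooth_on S (\<lambda>x. f x + g x)"
  by (simp add: smooth_on_def Ck_on_add)

lemma smooth_on_bounded_linear:
  "smooth_on S f \<Longrightarrow> bounded_linear L \<Longrightarrow> open S \<Longrightarrow> smooth_on S (\<lambda>x. L (f x))"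
  by (simp add: smooth_on_def Ck_on_bounded_linear)

lemma smooth_on_bounded_bilinear:
  "smooth_on S f \<Longrightarrow> smooth_on S g \<Longrightarrow> bounded_bilinear b \<Longrightarrow> open S \<Longrightarrow>
    smooth_on S (\<lambda>x. b (f x) (g x))"
  by (simp add: smooth_on_def Ck_on_bounded_bilinear)

lemma smooth_on_compose:
  fixes f :: "'a::real_normed_vector \<Rightarrow> 'b::euclidean_space"
  shows "smooth_on S f \<Longrightarrow> smooth_on T g \<Longrightarrow> f ` S \<subseteq> T \<Longrightarrow> open S \<Longrightarrow> smooth_on S (\<lambda>x. g (f x))"
  by (simp add: smooth_on_def Ck_on_compose)

lemmas smooth_on_fst = smooth_on_bounded_linear[OF _ bounded_linear_fst]
  and smooth_on_snd = smooth_on_bounded_linear[OF _ bounded_linear_snd]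
  and smooth_on_minus = smooth_on_bounded_linear[OF _ bounded_linear_minus[OF bounded_linear_ident]]
  and smooth_on_mult = smooth_on_bounded_bilinear[OF _ _ bounded_bilinear_mult]
  and smooth_on_scaleR = smooth_on_bounded_bilinear[OF _ _ bounded_bilinear_scaleR]
  and smooth_on_inner = smooth_on_bounded_bilinear[OF _ _ bounded_bilinear_inner]

lemma smooth_on_diff:
  "smooth_on S f \<Longrightarrow> smooth_on S g \<Longrightarrow> open S \<Longrightarrow> smooth_on S (\<lambda>x. f x - g x)"
  using smooth_on_add[OF _ smooth_on_minus[of S g]] by simp

lemma smooth_on_power:
  fixes f :: "'a::real_normed_vector \<Rightarrow> 'b::real_normed_algebra_1"
  shows "smooth_on S f \<Longrightarrow> open S \<Longrightarrow> smooth_on S (\<lambda>x. f x ^ n)"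
  by (induction n) (simp_all add: smooth_on_const smooth_on_mult)

lemma smooth_on_inverse:
  fixes f :: "'a::real_normed_vector \<Rightarrow> real"
  shows "smooth_on S f \<Longrightarrow> (\<And>x. x \<in> S \<Longrightarrow> f x \<noteq> 0) \<Longrightarrow> open S \<Longrightarrow> smooth_on S (\<lambda>x. inverse (f x))"
  by (simp add: smooth_on_def Ck_on_inverse)

lemma smooth_on_divide:
  fixes f :: "'a::real_normed_vector \<Rightarrow> real"
  shows "smooth_on S f \<Longrightarrow> smooth_on S g \<Longrightarrow> (\<And>x. x \<in> S \<Longrightarrow> g x \<noteq> 0) \<Longrightarrow> open S \<Longrightarrow>
    smooth_on S (\<lambda>x. f x / g x)"
  by (simp add: divide_inverse smooth_on_mult smooth_on_inverse)

lemma smooth_on_powr: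
  fixes f :: "'a::real_normed_vector \<Rightarrow> real"
  shows "smooth_on S f \<Longrightarrow> (\<And>x. x \<in> S \<Longrightarrow> f x > 0) \<Longrightarrow> open S \<Longrightarrow> smooth_on S (\<lambda>x. f x powr a)"
  by (simp add: smooth_on_def Ck_on_powr)

lemma smooth_on_sqrt:
  fixes f :: "'a::real_normed_vector \<Rightarrow> real"
  assumes "smooth_on S f" "\<And>x. x \<in> S \<Longrightarrow> f x > 0" "open S"
  shows "smooth_on S (\<lambda>x. sqrt (f x))"
  using smooth_on_powr[OF assms, of "1/2"] assms(2)
  by (subst smooth_on_cong[OF assms(3), of _ "\<lambda>x. f x powr (1/2)"])
    (simp_all add: powr_half_sqrt less_imp_le)

lemma smooth_on_norm:
  fixes f :: "'a::real_normed_vector \<Rightarrow> 'b::real_inner"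
  assumes "smooth_on S f" "\<And>x. x \<in> S \<Longrightarrow> f x \<noteq> 0" "open S"
  shows "smooth_on S (\<lambda>x. norm (f x))"
  unfolding norm_eq_sqrt_inner by (intro smooth_on_sqrt smooth_on_inner assms) (simp add: assms)

lemma smooth_on_Pair:
  fixes f :: "'a::real_normed_vector \<Rightarrow> 'b::real_normed_vector"
    and g :: "'a \<Rightarrow> 'c::real_normed_vector"
  assumes "smooth_on S f" "smooth_on S g" "open S"
  shows "smooth_on S (\<lambda>x. (f x, g x))"
proof -
  have "smooth_on S (\<lambda>x. (f x, 0) + (0, g x))"
    by (intro smooth_on_add smooth_on_bounded_linear[where L = "\<lambda>y. (y, 0)"]
        smooth_on_bounded_linear[where L = "\<lambda>y. (0, y)"] assms bounded_linear_Pair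
        bounded_linear_ident bounded_linear_zero)
  then show ?thesis by simp
qed

lemmas smooth_intros = smooth_on_const smooth_on_id smooth_on_fst smooth_on_snd smooth_on_add
  smooth_on_minus smooth_on_diff smooth_on_mult smooth_on_power smooth_on_divide smooth_on_scaleR
  smooth_on_inner smooth_on_Pair smooth_on_sqrt smooth_on_norm

text \<open>Smoothness in every fixed direction is smoothness as a map into the space of operators, because
an operator is the finite sum over a basis of its values there. This connects
\<^const>\<open>Ck_on\<close> with the operator-valued derivatives of the inverse function theorem.\<close>

lemma Ck_on_blinfun:
  fixes A :: "'a::real_normed_vector \<Rightarrow> 'b::euclidean_space \<Rightarrow>\<^sub>L 'c::real_normed_vector"
  assumes "open S" "\<And>i. Ck_on n S (\<lambda>x. A x i)"
  shows "Ck_on n S A"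
proof -
  let ?B = "\<lambda>i v. blinfun_scaleR_left v o\<^sub>L blinfun_inner_left i"
  have "A x = (\<Sum>i\<in>Basis. ?B i (A x i))" for x
  proof (rule blinfun_eqI)
    fix y
    have "A x (\<Sum>i\<in>Basis. (y \<bullet> i) *\<^sub>R i) = (\<Sum>i\<in>Basis. (y \<bullet> i) *\<^sub>R A x i)"
      by (simp add: blinfun.sum_right blinfun.scaleR_right)
    then have "A x y = (\<Sum>i\<in>Basis. (y \<bullet> i) *\<^sub>R A x i)" by (simp only: euclidean_representation)
    then show "A x y = (\<Sum>i\<in>Basis. ?B i (A x i)) y"
      by (simp add: blinfun.sum_left inner_commute)
  qed
  then have A: "A = (\<lambda>x. \<Sum>i\<in>Basis. ?B i (A x i))" by blast
  show ?thesis
    by (subst A) (intro Ck_on_sum Ck_on_bounded_linear[where L = "?B i" for i] assms finite_Basis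
        bounded_linear_compose[OF bounded_bilinear.bounded_linear_left[OF
          bounded_bilinear_blinfun_compose] bounded_linear_blinfun_scaleR_left])
qed

section \<open>The smooth inverse and implicit function theorems\<close>

text \<open>In a product whose second factor vanishes at the point, the first factor only needs to be
continuous. This breaks the circle in the differentiation of operator inverses below, where the
product contains the inverse itself, and it shortens derivatives at a zero later on.\<close>

lemma has_derivative_bilinear_vanishing:
  fixes c :: "'a::real_normed_vector \<Rightarrow> 'b::real_normed_vector"
    and f :: "'a \<Rightarrow> 'c::real_normed_vector"
  assumes b: "bounded_bilinear b" and c: "isCont c x"
    and f: "(f has_derivative f') (at x)" and "f x = 0"
  shows "((\<lambda>y. b (c y) (f y)) has_derivative (\<lambda>h. b (c x) (f' h))) (at x)"
proof -
  interpret b: bounded_bilinear b by fact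
  have f0: "bounded_linear f'" "((\<lambda>y. (f y - f' (y - x)) /\<^sub>R norm (y - x)) \<longlongrightarrow> 0) (at x)"
    using f \<open>f x = 0\<close> by (auto simp: has_derivative_at_within)
  obtain K where K: "\<And>h. norm (f' h) \<le> norm h * K"
    using bounded_linear.bounded[OF f0(1)] by blast
  let ?e = "\<lambda>y. (f y - f' (y - x)) /\<^sub>R norm (y - x)"
  obtain B where B: "B \<ge> 0" "\<And>p q. norm (b p q) \<le> norm p * norm q * B"
    using b.nonneg_bounded by blast
  let ?d = "\<lambda>y. norm (c y) * norm (?e y) * B + norm (c y - c x) * K * B"
  have "((\<lambda>y. norm ((b (c y) (f y) - b (c x) (f x) - b (c x) (f' (y - x))) /\<^sub>R norm (y - x))) \<longlongrightarrow> 0) (at x)"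
  proof (rule Lim_null_comparison)
    have "norm ((b (c y) (f y) - b (c x) (f x) - b (c x) (f' (y - x))) /\<^sub>R norm (y - x)) \<le> ?d y"
      if "y \<noteq> x" for y
    proof -
      have "(b (c y) (f y) - b (c x) (f x) - b (c x) (f' (y - x))) /\<^sub>R norm (y - x)
          = b (c y) (?e y) + b (c y - c x) (f' (y - x) /\<^sub>R norm (y - x))"
        using \<open>f x = 0\<close>
        by (simp add: b.scaleR_right b.diff_left b.diff_right b.zero_right scaleR_right_diff_distrib)
      also have "norm \<dots> \<le> norm (c y) * norm (?e y) * B
          + norm (c y - c x) * norm (f' (y - x) /\<^sub>R norm (y - x)) * B"
        by (intro norm_triangle_le add_mono B)
      also have "norm (f' (y - x) /\<^sub>R norm (y - x)) \<le> K"
        using K[of "y - x"] that by (simp add: divide_simps mult.commute)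
      then have "norm (c y - c x) * norm (f' (y - x) /\<^sub>R norm (y - x)) * B
          \<le> norm (c y - c x) * K * B"
        by (intro mult_right_mono mult_left_mono B) auto
      finally show ?thesis by simp
    qed
    then show "\<forall>\<^sub>F y in at x. norm (norm ((b (c y) (f y) - b (c x) (f x) - b (c x) (f' (y - x))) /\<^sub>R norm (y - x))) \<le> ?d y"
      by (auto simp: eventually_at_filter)
    have "(c \<longlongrightarrow> c x) (at x)" using c by (simp add: isCont_def)
    then have "(?d \<longlongrightarrow> norm (c x) * norm (0 :: 'c) * B + norm (0 :: 'b) * K * B) (at x)"
      by (intro tendsto_intros f0(2) LIM_zero)
    then show "(?d \<longlongrightarrow> 0) (at x)" by simp
  qed
  then have "((\<lambda>y. (b (c y) (f y) - b (c x) (f x) - b (c x) (f' (y - x))) /\<^sub>R norm (y - x)) \<longlongrightarrow> 0) (at x)"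
    by (rule tendsto_norm_zero_cancel)
  then show ?thesis
    by (simp add: has_derivative_at_within bounded_linear_compose[OF b.bounded_linear_right f0(1)])
qed

text \<open>The identity \<open>M y - M x = M y (A x - A y) M x\<close> first bounds the norm of \<open>M y\<close> by twice that of \<open>M x\<close>
near \<open>x\<close>, and then gives continuity.\<close>

lemma isCont_blinfun_inverse:
  fixes A :: "'a::real_normed_vector \<Rightarrow> 'b::real_normed_vector \<Rightarrow>\<^sub>L 'b"
  assumes "open S" "x \<in> S" "continuous_on S A"
    and AM: "\<And>y. y \<in> S \<Longrightarrow> A y o\<^sub>L M y = id_blinfun"
    and MA: "\<And>y. y \<in> S \<Longrightarrow> M y o\<^sub>L A y = id_blinfun"
  shows "isCont M x"
proof -
  have A: "(A \<longlongrightarrow> A x) (at x)"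
    using assms(1-3) by (metis continuous_on_eq_continuous_at isCont_def)
  have S: "\<forall>\<^sub>F y in at x. y \<in> S" using assms(1,2) by (simp add: eventually_at_in_open')
  have eq: "M y - M x = M y o\<^sub>L (A x - A y) o\<^sub>L M x" if "y \<in> S" for y
  proof (rule blinfun_eqI)
    fix i
    have "A x (M x i) = i" "M y (A y (M x i)) = M x i"
      using arg_cong[OF AM[OF \<open>x \<in> S\<close>], of "\<lambda>B. blinfun_apply B i"]
        arg_cong[OF MA[OF that], of "\<lambda>B. blinfun_apply B (M x i)"] by simp_all
    then show "(M y - M x) i = (M y o\<^sub>L (A x - A y) o\<^sub>L M x) i"
      by (simp add: blinfun.diff_left blinfun.diff_right)
  qed
  have "((\<lambda>y. norm (A x - A y) * norm (M x)) \<longlongrightarrow> 0) (at x)"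
    by (auto intro!: tendsto_eq_intros A)
  then have "\<forall>\<^sub>F y in at x. norm (A x - A y) * norm (M x) < 1/2"
    by (rule order_tendstoD) simp
  with S have "\<forall>\<^sub>F y in at x. norm (M y - M x) \<le> 2 * norm (M x) * (norm (A x - A y) * norm (M x))"
  proof eventually_elim
    case (elim y)
    have *: "norm (M y - M x) \<le> norm (M y) * (norm (A x - A y) * norm (M x))"
      unfolding eq[OF elim(1)] mult.assoc[symmetric]
      by (rule order_trans[OF norm_blinfun_compose mult_right_mono[OF norm_blinfun_compose]]) simp
    also have "\<dots> \<le> norm (M y) * (1/2)" using elim(2) by (intro mult_left_mono) auto
    finally have "norm (M y) \<le> 2 * norm (M x)" using norm_triangle_ineq2[of "M y" "M x"] by linarith
    then have "norm (M y) * (norm (A x - A y) * norm (M x)) \<le> 2 * norm (M x) * (norm (A x - A y) * norm (M x))"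
      by (intro mult_right_mono) auto
    with * show ?case by linarith
  qed
  moreover have "((\<lambda>y. 2 * norm (M x) * (norm (A x - A y) * norm (M x))) \<longlongrightarrow> 0) (at x)"
    by (auto intro!: tendsto_eq_intros A)
  ultimately have "((\<lambda>y. M y - M x) \<longlongrightarrow> 0) (at x)" by (rule Lim_null_comparison)
  then show ?thesis by (simp add: isCont_def LIM_zero_iff)
qed

text \<open>From the same identity, the derivative of \<open>M\<close> is \<open>- M (dA) M\<close>. It involves \<open>M\<close> only as a factor, so one
more derivative of \<open>A\<close> yields one more derivative of \<open>M\<close>.\<close>

lemma Ck_on_blinfun_inverse:
  fixes A :: "'a::real_normed_vector \<Rightarrow> 'b::real_normed_vector \<Rightarrow>\<^sub>L 'b"
  assumes "open S"
    and AM: "\<And>y. y \<in> S \<Longrightarrow> A y o\<^sub>L M y = id_blinfun"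
    and MA: "\<And>y. y \<in> S \<Longrightarrow> M y o\<^sub>L A y = id_blinfun"
  shows "Ck_on n S A \<Longrightarrow> Ck_on n S M"
proof (induction n)
  case 0
  then show ?case
    using isCont_blinfun_inverse[OF assms(1) _ _ AM MA]
    by (simp add: continuous_at_imp_continuous_on)
next
  case (Suc n)
  let ?A' = "\<lambda>x. frechet_derivative A (at x)"
  have cont: "continuous_on S A"
    using Suc.prems by (simp add: continuous_at_imp_continuous_on differentiable_imp_continuous_within)
  show ?case
  proof (rule Ck_on_SucI[OF assms(1)])
    fix x assume x: "x \<in> S"
    have "isCont M x" by (rule isCont_blinfun_inverse[OF assms(1) x cont]) (fact AM MA)+
    have "((\<lambda>y. A x - A y) has_derivative (\<lambda>h. - ?A' x h)) (at x)"
      by (rule derivative_eq_intros Ck_on_Suc_has_derivative[OF Suc.prems x] refl)+ simp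
    then have "((\<lambda>y. M y o\<^sub>L (A x - A y)) has_derivative (\<lambda>h. M x o\<^sub>L - ?A' x h)) (at x)"
      by (rule has_derivative_bilinear_vanishing[OF bounded_bilinear_blinfun_compose
            \<open>isCont M x\<close>]) auto
    from has_derivative_add[OF has_derivative_const bounded_linear.has_derivative[OF
          bounded_bilinear.bounded_linear_left[OF bounded_bilinear_blinfun_compose] this]]
    have "((\<lambda>y. M x + (M y o\<^sub>L (A x - A y) o\<^sub>L M x)) has_derivative
        (\<lambda>h. M x o\<^sub>L - ?A' x h o\<^sub>L M x)) (at x)"
      by simp
    then show "(M has_derivative (\<lambda>h. M x o\<^sub>L - ?A' x h o\<^sub>L M x)) (at x)"
    proof (rule has_derivative_transform_within_open[OF _ assms(1) x])
      fix y assume y: "y \<in> S"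
      have "A x (M x i) = i" "M y (A y j) = j" for i j
        using arg_cong[OF AM[OF x], of "\<lambda>B. blinfun_apply B i"]
          arg_cong[OF MA[OF y], of "\<lambda>B. blinfun_apply B j"] by simp_all
      then show "M x + (M y o\<^sub>L (A x - A y) o\<^sub>L M x) = M y"
        by (intro blinfun_eqI) (simp add: blinfun.diff_left blinfun.diff_right blinfun.add_left)
    qed
  next
    fix w
    have "Ck_on n S M" by (rule Suc.IH[OF Ck_on_SucD[OF Suc.prems]])
    then show "Ck_on n S (\<lambda>x. M x o\<^sub>L - ?A' x w o\<^sub>L M x)"
      using Suc.prems
      by (intro Ck_on_bounded_bilinear[OF _ bounded_bilinear_blinfun_compose] assms(1)
          Ck_on_bounded_linear[OF _ bounded_linear_minus[OF bounded_linear_ident]]) auto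
  qed
qed

text \<open>The derivative of the inverse \<open>g\<close> is the inverse of the operator \<open>f' (g y)\<close>. If \<open>g\<close> is \<open>C\<^sup>n\<close>, so is this
operator and hence its inverse; thus \<open>g\<close> is \<open>C\<^sup>n\<^sup>+\<^sup>1\<close>.\<close>

theorem smooth_inverse_function:
  fixes f :: "'a::euclidean_space \<Rightarrow> 'a"
  assumes "open S" "x0 \<in> S" and f: "smooth_on S f"
    and inj: "inj (frechet_derivative f (at x0))"
  obtains U V g where "open U" "U \<subseteq> S" "x0 \<in> U" "open V" "f x0 \<in> V" "homeomorphism U V f g"
    "smooth_on V g"
proof -
  define f' where "f' x = Blinfun (frechet_derivative f (at x))" for x
  have f'_apply: "blinfun_apply (f' x) = frechet_derivative f (at x)" if "x \<in> S" for x
    using has_derivative_bounded_linear[OF smooth_on_has_derivative[OF f that]]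
    by (simp add: f'_def bounded_linear_Blinfun_apply)
  have Ckf': "Ck_on n S f'" for n
  proof (rule Ck_on_blinfun[OF \<open>open S\<close>])
    show "Ck_on n S (\<lambda>x. f' x i)" for i
      using smooth_onD[OF smooth_on_frechet_derivative[OF f, of i], of n] f'_apply
      by (subst Ck_on_cong[OF \<open>open S\<close>, of _ "\<lambda>x. frechet_derivative f (at x) i"]) auto
  qed
  have f': "(f has_derivative f' x) (at x)" if "x \<in> S" for x
    using smooth_on_has_derivative[OF f that] by (simp add: f'_apply that)
  obtain i where i: "linear i" "i \<circ> frechet_derivative f (at x0) = id"
    using linear_injective_left_inverse[OF has_derivative_linear[OF
          smooth_on_has_derivative[OF f \<open>x0 \<in> S\<close>]] inj] by blast
  have inv: "Blinfun i o\<^sub>L f' x0 = id_blinfun"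
    using i f'_apply[OF \<open>x0 \<in> S\<close>]
    by (intro blinfun_eqI)
      (simp add: bounded_linear_Blinfun_apply linear_conv_bounded_linear o_def fun_eq_iff)
  have "continuous_on S f'" using Ckf'[of 0] by simp
  from inverse_function_theorem[OF \<open>open S\<close> f' this \<open>x0 \<in> S\<close> inv]
  obtain U V g g' where UV: "open U" "U \<subseteq> S" "x0 \<in> U" "open V" "f x0 \<in> V" "homeomorphism U V f g"
    and g': "\<And>y. y \<in> V \<Longrightarrow> (g has_derivative g' y) (at y)"
    and g'_eq: "\<And>y. y \<in> V \<Longrightarrow> g' y = inv (blinfun_apply (f' (g y)))"
    and bij: "\<And>y. y \<in> V \<Longrightarrow> bij (blinfun_apply (f' (g y)))"
    by metis
  define M where "M y = Blinfun (g' y)" for y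
  have M_apply: "blinfun_apply (M y) = g' y" if "y \<in> V" for y
    using has_derivative_bounded_linear[OF g'[OF that]]
    by (simp add: M_def bounded_linear_Blinfun_apply)
  have gV: "g ` V \<subseteq> S" using UV(2,6) by (auto simp: homeomorphism_def)
  have "Ck_on n V g" for n
  proof (induction n)
    case 0
    show ?case using UV(6) by (simp add: homeomorphism_def)
  next
    case (Suc n)
    have "Ck_on n V M"
    proof (rule Ck_on_blinfun_inverse[OF \<open>open V\<close>])
      show "Ck_on n V (\<lambda>y. f' (g y))"
        by (rule Ck_on_compose[OF \<open>open V\<close> gV Suc.IH Ckf'])
      fix y assume "y \<in> V"
      then show "f' (g y) o\<^sub>L M y = id_blinfun" "M y o\<^sub>L f' (g y) = id_blinfun"
        using bij[of y] by (auto intro!: blinfun_eqI simp: M_apply g'_eq bij_is_surj surj_f_inv_f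
            bij_is_inj inv_f_f)
    qed
    then have "Ck_on n V (\<lambda>y. M y w)" for w
      by (rule Ck_on_bounded_linear[OF \<open>open V\<close> bounded_linear_apply_blinfun])
    then show ?case
      using g' by (intro Ck_on_SucI[OF \<open>open V\<close>, of g "\<lambda>y. blinfun_apply (M y)"]) (auto simp: M_apply)
  qed
  then show thesis using that[OF UV] by (simp add: smooth_on_def)
qed

text \<open>Invert \<open>(p, s) \<mapsto> (p, F (p, s))\<close> and restrict the inverse to the slice where \<open>F\<close> is zero.\<close>

lemma smooth_implicit_function:
  fixes F :: "'a::euclidean_space \<times> real \<Rightarrow> real"
  assumes "open S" "(p0, s0) \<in> S" and F: "smooth_on S F" and "F (p0, s0) = 0"
    and nz: "frechet_derivative F (at (p0, s0)) (0, 1) \<noteq> 0"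
  obtains U \<sigma> where "open U" "p0 \<in> U" "smooth_on U \<sigma>" "\<sigma> p0 = s0"
    "\<And>p. p \<in> U \<Longrightarrow> (p, \<sigma> p) \<in> S \<and> F (p, \<sigma> p) = 0"
proof -
  let ?G = "\<lambda>z. (fst z, F z)" and ?F' = "frechet_derivative F (at (p0, s0))"
  have F': "(F has_derivative ?F') (at (p0, s0))"
    by (rule smooth_on_has_derivative[OF F assms(2)])
  then have dG: "(?G has_derivative (\<lambda>h. (fst h, ?F' h))) (at (p0, s0))"
    by (intro has_derivative_Pair bounded_linear_imp_has_derivative bounded_linear_fst)
  note G' = frechet_derivative_at[OF dG, symmetric] and linG = has_derivative_linear[OF dG]
  have "h = 0" if fst0: "fst h = 0" and F0: "?F' h = 0" for h
  proof -
    obtain t where h: "h = (0, t)" using fst0 by (metis prod.collapse)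
    have "?F' (0, t) = t * ?F' (0, 1)"
      using linear_scale[OF has_derivative_linear[OF F'], of t "(0, 1)"] by simp
    then show ?thesis using F0 nz by (simp add: h zero_prod_def)
  qed
  then have inj: "inj (frechet_derivative ?G (at (p0, s0)))"
    unfolding G' by (subst linear_injective_0[OF linG]) (simp add: zero_prod_def)
  have "smooth_on S ?G" by (intro smooth_intros F assms(1))
  then obtain U V g where UV: "open U" "U \<subseteq> S" "(p0, s0) \<in> U" "open V" "?G (p0, s0) \<in> V"
      "homeomorphism U V ?G g" "smooth_on V g"
    by (rule smooth_inverse_function[OF assms(1,2) _ inj])
  let ?W = "{p. (p, 0) \<in> V}" and ?\<sigma> = "\<lambda>p. snd (g (p, 0))"
  have "?W = (\<lambda>p. (p, 0)) -` V" by auto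
  then have W: "open ?W"
    using open_vimage[OF UV(4), of "\<lambda>p. (p, 0)"] by (simp add: continuous_on_Pair)
  have g: "g (p, 0) = (p, ?\<sigma> p) \<and> F (g (p, 0)) = 0 \<and> g (p, 0) \<in> S" if "p \<in> ?W" for p
  proof -
    have "?G (g (p, 0)) = (p, 0)" "g (p, 0) \<in> U"
      using UV(6) that by (auto simp: homeomorphism_def)
    then show ?thesis using UV(2) by (auto simp: prod_eq_iff)
  qed
  show thesis
  proof
    show "open ?W" by (fact W)
    show "p0 \<in> ?W" using UV(5) assms(4) by simp
    show "smooth_on ?W ?\<sigma>"
      by (intro smooth_on_snd smooth_on_compose[OF _ UV(7)] smooth_on_Pair smooth_on_id
          smooth_on_const W) auto
    show "?\<sigma> p0 = s0"
      using homeomorphism_apply1[OF UV(6,3)] assms(4) by simp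
    show "(p, ?\<sigma> p) \<in> S \<and> F (p, ?\<sigma> p) = 0" if "p \<in> ?W" for p
    proof -
      have "(p, ?\<sigma> p) = g (p, 0)" using g[OF that] by (simp add: prod_eq_iff)
      then show ?thesis using g[OF that] by (simp only: simp_thms)
    qed
  qed
qed

lemma continuous_on_positive_neighbourhood:
  fixes g :: "'a::topological_space \<Rightarrow> real"
  assumes "continuous_on S g" "open S" "x \<in> S" "g x > 0"
  obtains U where "open U" "x \<in> U" "U \<subseteq> S" "\<And>y. y \<in> U \<Longrightarrow> g y > 0"
proof
  show "open (S \<inter> g -` {0<..})" by (rule continuous_open_preimage[OF assms(1,2)]) simp
qed (use assms in auto)

section \<open>Functions with a \<open>D\<^sub>4\<close> singularity\<close>

text \<open>The reparametrisation that brings \<open>k\<close> to the form \<open>N\<close> is the inverse of \<open>\<Theta>\<close>.\<close>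

lemma right_equivalentI:
  assumes "open S" "0 \<in> S" "smooth_on S \<Theta>" "\<Theta> 0 = 0" "inj (frechet_derivative \<Theta> (at 0))"
    and k: "\<And>p. p \<in> S \<Longrightarrow> k p = N (\<Theta> p)"
  shows "right_equivalent k N"
proof -
  obtain U V g where UV: "open U" "U \<subseteq> S" "0 \<in> U" "open V" "\<Theta> 0 \<in> V" "homeomorphism U V \<Theta> g"
    "smooth_on V g"
    by (rule smooth_inverse_function[OF assms(1-3,5)])
  have "N q = k (g q)" if "q \<in> V" for q
  proof -
    have "g q \<in> U" "\<Theta> (g q) = q" using UV(6) that by (auto simp: homeomorphism_def)
    then show ?thesis using k[of "g q"] UV(2) by auto
  qed
  moreover have "g 0 = 0" using UV(3,6) assms(4) by (metis homeomorphism_apply1)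
  ultimately show ?thesis
    unfolding right_equivalent_def
    using UV assms(4) smooth_on_subset[OF assms(3) UV(2)] homeomorphism_symD[OF UV(6)]
    by (intro exI[of _ V] exI[of _ U] exI[of _ g] exI[of _ \<Theta>]) auto
qed

text \<open>The intermediate value theorem applied on \<open>[-R, R]\<close>, where the cubic term dominates at the ends.\<close>

lemma depressed_cubic_real_root:
  fixes a c d :: real
  assumes "a \<noteq> 0"
  obtains s where "a * s ^ 3 + c * s + d = 0"
proof -
  define p q where "p = c / a" and "q = d / a"
  define R where "R = 1 + \<bar>p\<bar> + \<bar>q\<bar>"
  have "R * R \<ge> R * 1" by (intro mult_left_mono) (auto simp: R_def)
  then have "R * (R * R - \<bar>p\<bar>) \<ge> R * (1 + \<bar>q\<bar>)" by (intro mult_left_mono) (auto simp: R_def)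
  moreover have "R * (1 + \<bar>q\<bar>) \<ge> 1 * (1 + \<bar>q\<bar>)" by (intro mult_right_mono) (auto simp: R_def)
  ultimately have *: "R ^ 3 - \<bar>p\<bar> * R - \<bar>q\<bar> \<ge> 1" by (simp add: power3_eq_cube algebra_simps)
  have "\<bar>p * R\<bar> = \<bar>p\<bar> * R" by (simp add: abs_mult R_def)
  then have "R ^ 3 + p * R + q \<ge> 0" "(- R) ^ 3 + p * (- R) + q \<le> 0"
    using * by (auto simp: power3_eq_cube)
  moreover have "- R \<le> R" by (simp add: R_def)
  moreover have "continuous_on {- R..R} (\<lambda>s. s ^ 3 + p * s + q)" by (intro continuous_intros)
  ultimately obtain s where "s ^ 3 + p * s + q = 0"
    using IVT'[of "\<lambda>s. s ^ 3 + p * s + q" "- R" 0 R] by blast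
  then have "a * (s ^ 3 + p * s + q) = 0" by simp
  then have "a * s ^ 3 + c * s + d = 0" using assms by (simp add: p_def q_def algebra_simps)
  then show thesis by (rule that)
qed

text \<open>At every point \<open>p = (u, v)\<close> the value \<open>k p\<close> is a binary cubic in \<open>u\<close>, \<open>v\<close> whose coefficients are \<open>a p\<close>,
\<open>c p\<close>, \<open>d p\<close>. With a root \<open>\<sigma>\<close> of \<open>a s\<^sup>3 + c s + d\<close> it equals \<open>x\<close> times a quadratic form in \<open>x\<close> and \<open>v\<close>, where
\<open>x = u - \<sigma> v\<close>; completing the square makes this \<open>x (\<delta> x\<^sup>2 + \<gamma> y\<^sup>2)\<close>. The discriminant being nonzero says
that \<open>\<sigma>\<close> is a simple root, which is \<open>\<gamma> \<noteq> 0\<close>, and that the quadratic factor is nondegenerate, which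
amounts to \<open>\<delta> \<noteq> 0\<close>. All these quantities depend smoothly on \<open>p\<close>, so the normalisation is a change of
coordinates.\<close>

lemma has_D4_singularityI:
  fixes a c d k :: "real \<times> real \<Rightarrow> real"
  assumes "smooth_near 0 a" "smooth_near 0 c" "smooth_near 0 d"
    and a0: "a 0 \<noteq> 0" and disc: "4 * c 0 ^ 3 + 27 * a 0 * (d 0)\<^sup>2 \<noteq> 0"
    and k: "\<And>u v. k (u, v) = a (u, v) * u ^ 3 + c (u, v) * u * v\<^sup>2 + d (u, v) * v ^ 3"
  shows "has_D4_singularity k"
proof -
  obtain S where S: "open S" "0 \<in> S" and acd: "smooth_on S a" "smooth_on S c" "smooth_on S d"
  proof -
    obtain A C D where "open A" "0 \<in> A" "smooth_on A a" "open C" "0 \<in> C" "smooth_on C c"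
      "open D" "0 \<in> D" "smooth_on D d"
      using assms(1-3) unfolding smooth_near_def by metis
    then show thesis
      by (intro that[of "A \<inter> C \<inter> D"]) (auto elim: smooth_on_subset)
  qed
  obtain s0 where s0: "a 0 * s0 ^ 3 + c 0 * s0 + d 0 = 0"
    by (rule depressed_cubic_real_root[OF a0])
  then have d0: "d 0 = - (a 0 * s0 ^ 3 + c 0 * s0)" by simp
  \<comment> \<open>\<open>s0\<close> is not a double root, so the implicit function theorem applies to it\<close>
  have simple: "c 0 + 3 * a 0 * s0\<^sup>2 \<noteq> 0"
  proof
    assume "c 0 + 3 * a 0 * s0\<^sup>2 = 0"
    then have c: "c 0 = - 3 * a 0 * s0\<^sup>2" by simp
    have "d 0 = 2 * a 0 * s0 ^ 3" unfolding d0 c by algebra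
    with c have "4 * c 0 ^ 3 + 27 * a 0 * (d 0)\<^sup>2 = 0" by algebra
    with disc show False by simp
  qed
  \<comment> \<open>the quadratic factor \<open>a s\<^sup>2 + a s0 s + (c + a s0\<^sup>2)\<close> has no double root\<close>
  have other: "4 * c 0 + 3 * a 0 * s0\<^sup>2 \<noteq> 0"
  proof
    assume "4 * c 0 + 3 * a 0 * s0\<^sup>2 = 0"
    then have "a 0 * s0\<^sup>2 = - 4 / 3 * c 0" by simp
    with d0 have "4 * c 0 ^ 3 + 27 * a 0 * (d 0)\<^sup>2 = 0" by algebra
    with disc show False by simp
  qed
  let ?F = "\<lambda>z. a (fst z) * snd z ^ 3 + c (fst z) * snd z + d (fst z)"
  have SU: "open (S \<times> (UNIV :: real set))" using S(1) by (intro open_Times) auto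
  have F: "smooth_on (S \<times> UNIV) ?F"
  proof -
    have fst: "smooth_on (S \<times> (UNIV :: real set)) (\<lambda>z. b (fst z))" if "smooth_on S b"
      for b :: "real \<times> real \<Rightarrow> real"
      by (intro smooth_on_compose[OF _ that] smooth_intros SU) auto
    show ?thesis by (intro smooth_intros SU fst acd)
  qed
  have F': "frechet_derivative ?F (at (0, s0)) (0, 1) = c 0 + 3 * a 0 * s0\<^sup>2"
  proof -
    have *: "((\<lambda>z. b (fst z)) has_derivative (\<lambda>h. frechet_derivative b (at 0) (fst h))) (at (0, s0))"
      if "smooth_on S b" for b :: "real \<times> real \<Rightarrow> real"
    proof (rule has_derivative_compose[OF bounded_linear_imp_has_derivative[OF bounded_linear_fst]])
      show "(b has_derivative frechet_derivative b (at 0)) (at (fst (0, s0)))"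
        using smooth_on_has_derivative[OF that S(2)] by simp
    qed
    have lin: "frechet_derivative b (at 0) 0 = 0" if "smooth_on S b" for b :: "real \<times> real \<Rightarrow> real"
      using has_derivative_linear[OF smooth_on_has_derivative[OF that S(2)]] by (rule linear_0)
    have "(?F has_derivative (\<lambda>h. (a 0 * (3 * (snd h * s0\<^sup>2)) + frechet_derivative a (at 0) (fst h) * s0 ^ 3)
        + (c 0 * snd h + frechet_derivative c (at 0) (fst h) * s0) + frechet_derivative d (at 0) (fst h)))
        (at (0, s0))"
      by (rule derivative_eq_intros * acd refl ext | simp)+
    from frechet_derivative_at[OF this, symmetric] show ?thesis
      using lin[OF acd(1)] lin[OF acd(2)] lin[OF acd(3)] by (simp add: zero_prod_def)
  qed
  obtain U \<sigma> where U: "open U" "0 \<in> U" "U \<subseteq> S" and \<sigma>: "smooth_on U \<sigma>" "\<sigma> 0 = s0"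
    and root: "\<And>p. p \<in> U \<Longrightarrow> d p = - (a p * \<sigma> p ^ 3 + c p * \<sigma> p)"
  proof -
    obtain U \<sigma> where "open U" "0 \<in> U" "smooth_on U \<sigma>" "\<sigma> 0 = s0"
      and U: "\<And>p. p \<in> U \<Longrightarrow> (p, \<sigma> p) \<in> S \<times> UNIV \<and> ?F (p, \<sigma> p) = 0"
      using smooth_implicit_function[OF SU _ F, of 0 s0] s0 simple F' S(2) by auto
    moreover have "d p = - (a p * \<sigma> p ^ 3 + c p * \<sigma> p)" "p \<in> S" if "p \<in> U" for p
      using U[OF that] by auto
    ultimately show thesis by (intro that[of U \<sigma>]) blast+
  qed
  note acdU = acd[THEN smooth_on_subset, OF U(3)]
  \<comment> \<open>\<open>\<gamma>\<close> is the derivative of the cubic polynomial at its root, \<open>\<kappa>\<close> the shift that completes the square\<close>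
  define \<gamma> where "\<gamma> p = c p + 3 * a p * (\<sigma> p)\<^sup>2" for p
  have \<gamma>: "smooth_on U \<gamma>" unfolding \<gamma>_def by (intro smooth_intros acdU \<sigma> U(1))
  define e1 where "e1 = sgn (\<gamma> 0)"
  have e1: "e1 * e1 = 1" "e1 * \<gamma> 0 > 0"
    using simple by (auto simp: e1_def \<gamma>_def \<sigma>(2) sgn_if)
  have "continuous_on U (\<lambda>p. e1 * \<gamma> p)"
    by (intro continuous_intros smooth_on_imp_continuous_on[OF \<gamma>])
  from continuous_on_positive_neighbourhood[OF this U(1,2) e1(2)]
  obtain V where V: "open V" "0 \<in> V" "V \<subseteq> U" and V_pos: "\<And>p. p \<in> V \<Longrightarrow> e1 * \<gamma> p > 0"
    by blast
  have \<gamma>_nz: "\<gamma> p \<noteq> 0" if "p \<in> V" for p using V_pos[OF that] by auto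
  note acdV = acdU[THEN smooth_on_subset, OF V(3)] and \<sigma>V = smooth_on_subset[OF \<sigma>(1) V(3)]
    and \<gamma>V = smooth_on_subset[OF \<gamma> V(3)]
  define \<kappa> where "\<kappa> p = 3 * a p * \<sigma> p / (2 * \<gamma> p)" for p
  define \<delta> where "\<delta> p = a p - \<gamma> p * (\<kappa> p)\<^sup>2" for p
  have \<kappa>: "smooth_on V \<kappa>" unfolding \<kappa>_def
    by (intro smooth_intros acdV \<sigma>V \<gamma>V V(1)) (use \<gamma>_nz in auto)
  have \<delta>: "smooth_on V \<delta>" unfolding \<delta>_def by (intro smooth_intros acdV \<kappa> \<gamma>V V(1))
  have "4 * \<gamma> 0 * \<delta> 0 = a 0 * (4 * c 0 + 3 * a 0 * s0\<^sup>2)"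
  proof -
    have "2 * \<gamma> 0 * \<kappa> 0 = 3 * a 0 * s0" using \<gamma>_nz[OF V(2)] by (simp add: \<kappa>_def \<sigma>(2))
    moreover have "\<gamma> 0 = c 0 + 3 * a 0 * s0\<^sup>2" by (simp add: \<gamma>_def \<sigma>(2))
    ultimately show ?thesis unfolding \<delta>_def by algebra
  qed
  then have \<delta>_nz: "\<delta> 0 \<noteq> 0" using a0 other by auto
  define e2 where "e2 = sgn (\<delta> 0)"
  have e2: "e2 * e2 = 1" "e2 * \<delta> 0 > 0" using \<delta>_nz by (auto simp: e2_def sgn_if)
  have "continuous_on V (\<lambda>p. e2 * \<delta> p)"
    by (intro continuous_intros smooth_on_imp_continuous_on[OF \<delta>])
  from continuous_on_positive_neighbourhood[OF this V(1,2) e2(2)]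
  obtain W where W: "open W" "0 \<in> W" "W \<subseteq> V" and W_pos: "\<And>p. p \<in> W \<Longrightarrow> e2 * \<delta> p > 0"
    by blast
  have WU: "W \<subseteq> U" using W V by blast
  note acdW = acdV[THEN smooth_on_subset, OF W(3)] and \<sigma>W = smooth_on_subset[OF \<sigma>V W(3)]
    and \<gamma>W = smooth_on_subset[OF \<gamma>V W(3)] and \<kappa>W = smooth_on_subset[OF \<kappa> W(3)]
    and \<delta>W = smooth_on_subset[OF \<delta> W(3)]
  \<comment> \<open>\<open>e2 * r\<close> is the real cube root of \<open>\<delta>\<close>; the sign keeps the base of the power positive\<close>
  define r where "r p = (e2 * \<delta> p) powr (1/3)" for p
  have r: "smooth_on W r" unfolding r_def
    by (intro smooth_on_powr smooth_intros \<delta>W W(1)) (rule W_pos)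
  have r_pos: "r p > 0" if "p \<in> W" for p using W_pos[OF that] by (auto simp: r_def)
  have r3: "r p ^ 3 = e2 * \<delta> p" if "p \<in> W" for p
  proof -
    have "r p ^ 3 = r p powr 3" using r_pos[OF that] by simp
    also have "\<dots> = e2 * \<delta> p" using W_pos[OF that] by (simp only: r_def powr_powr) simp
    finally show ?thesis .
  qed
  define n where "n p = sqrt (e1 * \<gamma> p / r p)" for p
  have n_pos: "n p > 0" and n2: "(n p)\<^sup>2 * r p = e1 * \<gamma> p" if "p \<in> W" for p
    using V_pos[of p] r_pos[OF that] W(3) that by (auto simp: n_def)
  have n: "smooth_on W n" unfolding n_def
  proof (intro smooth_intros \<gamma>W r W(1))
    show "r p \<noteq> 0" if "p \<in> W" for p using r_pos[OF that] by simp
    show "e1 * \<gamma> p / r p > 0" if "p \<in> W" for p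
      using V_pos[of p] r_pos[OF that] W(3) that by auto
  qed
  define x where "x p = fst p - \<sigma> p * snd p" for p
  define y where "y p = snd p + \<kappa> p * x p" for p
  define \<Theta> where "\<Theta> p = (e2 * r p * x p, n p * y p)" for p
  have x: "smooth_on W x" unfolding x_def by (intro smooth_intros \<sigma>W W(1))
  have y: "smooth_on W y" unfolding y_def by (intro smooth_intros \<kappa>W x W(1))
  have \<Theta>: "smooth_on W \<Theta>" unfolding \<Theta>_def by (intro smooth_intros r n x y W(1))
  have [simp]: "x 0 = 0" "y 0 = 0" by (simp_all add: x_def y_def)
  have cont0: "isCont g 0" if "smooth_on W g" for g :: "real \<times> real \<Rightarrow> real"
    using smooth_on_imp_continuous_on[OF that] W(1,2) by (simp add: continuous_on_eq_continuous_at)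
  note vanish = has_derivative_bilinear_vanishing[OF bounded_bilinear_mult]
  \<comment> \<open>\<open>x\<close> and \<open>y\<close> vanish at \<open>0\<close>, so the derivatives of their coefficients do not enter at \<open>0\<close>\<close>
  have x': "(x has_derivative (\<lambda>h. fst h - s0 * snd h)) (at 0)"
    unfolding x_def \<sigma>(2)[symmetric]
    by (intro has_derivative_diff vanish cont0 \<sigma>W bounded_linear_imp_has_derivative
        bounded_linear_fst bounded_linear_snd) simp
  have y': "(y has_derivative (\<lambda>h. snd h + \<kappa> 0 * (fst h - s0 * snd h))) (at 0)"
    unfolding y_def
    by (intro has_derivative_add vanish cont0 \<kappa>W x' bounded_linear_imp_has_derivative
        bounded_linear_snd) simp
  have \<Theta>': "(\<Theta> has_derivative (\<lambda>h. (e2 * r 0 * (fst h - s0 * snd h),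
      n 0 * (snd h + \<kappa> 0 * (fst h - s0 * snd h))))) (at 0)"
    unfolding \<Theta>_def
    by (intro has_derivative_Pair vanish cont0 r n x' y' smooth_intros W(1)) simp_all
  have \<Theta>0: "\<Theta> 0 = 0" by (simp add: \<Theta>_def zero_prod_def[symmetric])
  have inj: "inj (frechet_derivative \<Theta> (at 0))"
  proof -
    have "h = 0" if h: "e2 * r 0 * (fst h - s0 * snd h) = 0"
      "n 0 * (snd h + \<kappa> 0 * (fst h - s0 * snd h)) = 0" for h :: "real \<times> real"
    proof -
      have "fst h - s0 * snd h = 0" using h(1) e2 r_pos[OF W(2)] by auto
      moreover from this have "snd h = 0" using h(2) n_pos[OF W(2)] by simp
      ultimately show ?thesis by (simp add: prod_eq_iff)
    qed
    then show ?thesis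
      unfolding frechet_derivative_at[OF \<Theta>', symmetric]
      by (subst linear_injective_0[OF has_derivative_linear[OF \<Theta>']]) (simp add: zero_prod_def)
  qed
  have normal_form: "k p = fst (\<Theta> p) ^ 3 + e1 * e2 * (fst (\<Theta> p) * (snd (\<Theta> p))\<^sup>2)" if p: "p \<in> W" for p
  proof -
    obtain u v where uv: "p = (u, v)" by (cases p)
    have u: "u = x p + \<sigma> p * v" and v: "v = y p - \<kappa> p * x p" by (simp_all add: x_def y_def uv)
    have "2 * \<gamma> p * \<kappa> p = 3 * a p * \<sigma> p" using \<gamma>_nz[of p] W(3) p by (auto simp: \<kappa>_def)
    have d: "d p = - (a p * \<sigma> p ^ 3 + c p * \<sigma> p)" using root p WU by blast
    have "k p = a p * u ^ 3 + c p * u * v\<^sup>2 + d p * v ^ 3" using k[of u v] by (simp only: uv)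
    also have "\<dots> = x p * (a p * (x p)\<^sup>2 + 3 * a p * \<sigma> p * x p * v + \<gamma> p * v\<^sup>2)"
      using d unfolding u \<gamma>_def by algebra
    also have "\<dots> = x p * (\<delta> p * (x p)\<^sup>2 + \<gamma> p * (y p)\<^sup>2)"
      using \<open>2 * \<gamma> p * \<kappa> p = 3 * a p * \<sigma> p\<close> unfolding \<delta>_def v by algebra
    also have "\<dots> = fst (\<Theta> p) ^ 3 + e1 * e2 * (fst (\<Theta> p) * (snd (\<Theta> p))\<^sup>2)"
      using r3[OF p] n2[OF p] e1(1) e2(1) unfolding \<Theta>_def fst_conv snd_conv by algebra
    finally show ?thesis .
  qed
  have "e1 * e2 = 1 \<or> e1 * e2 = - 1"
    using simple \<delta>_nz by (auto simp: e1_def e2_def \<gamma>_def \<sigma>(2) sgn_if)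
  then show ?thesis
  proof
    assume *: "e1 * e2 = 1"
    have "right_equivalent k (\<lambda>(u, v). u ^ 3 + u * v\<^sup>2)"
      by (rule right_equivalentI[OF W(1,2) \<Theta> \<Theta>0 inj])
        (simp add: normal_form case_prod_unfold *)
    then show ?thesis by (simp add: has_D4_singularity_def)
  next
    assume *: "e1 * e2 = - 1"
    have "right_equivalent k (\<lambda>(u, v). u ^ 3 - u * v\<^sup>2)"
      by (rule right_equivalentI[OF W(1,2) \<Theta> \<Theta>0 inj])
        (simp add: normal_form case_prod_unfold *)
    then show ?thesis by (simp add: has_D4_singularity_def)
  qed
qed

lemma smooth_near_imp_isCont:
  "smooth_near x f \<Longrightarrow> isCont f x"
  unfolding smooth_near_def
  by (metis smooth_on_imp_continuous_on continuous_on_eq_continuous_at)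

text \<open>Comparing \<open>k (\<theta> (t w)) / t\<^sup>3\<close> with \<open>N (t w) / t\<^sup>3 = N w\<close> as \<open>t\<close> tends to \<open>0\<close>: a diffeomorphism acts on
leading cubic forms through its derivative at \<open>0\<close>.\<close>

lemma cubic_normal_form_tangent:
  fixes a c d k :: "real \<times> real \<Rightarrow> real" and \<theta> T :: "real \<times> real \<Rightarrow> real \<times> real"
  assumes cont: "isCont a 0" "isCont c 0" "isCont d 0"
    and k: "\<And>u v. k (u, v) = a (u, v) * u ^ 3 + c (u, v) * u * v\<^sup>2 + d (u, v) * v ^ 3"
    and U: "open U" "0 \<in> U" and T: "(\<theta> has_derivative T) (at 0)" and "\<theta> 0 = 0"
    and \<theta>: "\<And>p. p \<in> U \<Longrightarrow> k (\<theta> p) = N p"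
    and N: "\<And>t p. N (t *\<^sub>R p) = t ^ 3 * N p"
  shows "N w = a 0 * fst (T w) ^ 3 + c 0 * fst (T w) * (snd (T w))\<^sup>2 + d 0 * snd (T w) ^ 3"
proof -
  let ?x = "\<lambda>t. fst (\<theta> (t *\<^sub>R w)) / t" and ?y = "\<lambda>t. snd (\<theta> (t *\<^sub>R w)) / t"
  have ray: "((\<lambda>t. t *\<^sub>R w) \<longlongrightarrow> 0) (at 0)" by (auto intro!: tendsto_eq_intros)
  have ray': "((\<lambda>t. \<theta> (t *\<^sub>R w)) has_derivative (\<lambda>t. T (t *\<^sub>R w))) (at 0)"
    by (rule has_derivative_compose[of "\<lambda>t. t *\<^sub>R w"])
      (use T in \<open>auto intro!: derivative_eq_intros\<close>)
  have T_scale: "T (t *\<^sub>R w) = t *\<^sub>R T w" for t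
    by (rule linear_scale[OF has_derivative_linear[OF T]])
  have "((\<lambda>t. fst (\<theta> (t *\<^sub>R w))) has_real_derivative fst (T w)) (at 0)"
    using has_derivative_fst[OF ray'] by (simp add: has_field_derivative_def T_scale mult_commute_abs)
  then have x: "(?x \<longlongrightarrow> fst (T w)) (at 0)"
    using \<open>\<theta> 0 = 0\<close> by (simp add: DERIV_def)
  have "((\<lambda>t. snd (\<theta> (t *\<^sub>R w))) has_real_derivative snd (T w)) (at 0)"
    using has_derivative_snd[OF ray'] by (simp add: has_field_derivative_def T_scale mult_commute_abs)
  then have y: "(?y \<longlongrightarrow> snd (T w)) (at 0)"
    using \<open>\<theta> 0 = 0\<close> by (simp add: DERIV_def)
  have \<theta>_ray: "((\<lambda>t. \<theta> (t *\<^sub>R w)) \<longlongrightarrow> 0) (at 0)"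
    using has_derivative_continuous[OF ray'] \<open>\<theta> 0 = 0\<close> by (simp add: isCont_def)
  have coeff: "((\<lambda>t. b (\<theta> (t *\<^sub>R w))) \<longlongrightarrow> b 0) (at 0)" if "isCont b 0" for b :: "real \<times> real \<Rightarrow> real"
    by (rule isCont_tendsto_compose[OF that \<theta>_ray])
  have lim: "((\<lambda>t. a (\<theta> (t *\<^sub>R w)) * ?x t ^ 3 + c (\<theta> (t *\<^sub>R w)) * ?x t * (?y t)\<^sup>2
      + d (\<theta> (t *\<^sub>R w)) * ?y t ^ 3) \<longlongrightarrow>
      a 0 * fst (T w) ^ 3 + c 0 * fst (T w) * (snd (T w))\<^sup>2 + d 0 * snd (T w) ^ 3) (at 0)"
    by (intro tendsto_intros coeff cont x y)
  have "\<forall>\<^sub>F t in at 0. t *\<^sub>R w \<in> U" by (rule topological_tendstoD[OF ray U])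
  moreover have "\<forall>\<^sub>F t in at 0. t \<noteq> (0 :: real)" by (simp add: eventually_at_filter)
  ultimately have "\<forall>\<^sub>F t in at 0. a (\<theta> (t *\<^sub>R w)) * ?x t ^ 3 + c (\<theta> (t *\<^sub>R w)) * ?x t * (?y t)\<^sup>2
      + d (\<theta> (t *\<^sub>R w)) * ?y t ^ 3 = N w"
  proof eventually_elim
    case (elim t)
    have "t ^ 3 * N w = k (fst (\<theta> (t *\<^sub>R w)), snd (\<theta> (t *\<^sub>R w)))"
      using \<theta>[OF elim(1)] N by simp
    then show ?case
      unfolding k using elim(2) by (simp add: field_simps power2_eq_square power3_eq_cube)
  qed
  then have "((\<lambda>t. a (\<theta> (t *\<^sub>R w)) * ?x t ^ 3 + c (\<theta> (t *\<^sub>R w)) * ?x t * (?y t)\<^sup>2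
      + d (\<theta> (t *\<^sub>R w)) * ?y t ^ 3) \<longlongrightarrow> N w) (at 0)"
    by (rule tendsto_eventually)
  from tendsto_unique[OF _ this lim] show ?thesis by simp
qed

text \<open>If the discriminant vanishes, the cubic form has a critical point \<open>p \<noteq> 0\<close>, and the
derivative of the equivalence at \<open>0\<close> pulls it back to a critical point \<open>w \<noteq> 0\<close> of
\<open>u\<^sup>3 + e u v\<^sup>2\<close> with \<open>e = \<plusminus>1\<close>, which does not exist.\<close>

lemma has_D4_singularityD:
  fixes a c d k :: "real \<times> real \<Rightarrow> real"
  assumes "isCont a 0" "isCont c 0" "isCont d 0"
    and k: "\<And>u v. k (u, v) = a (u, v) * u ^ 3 + c (u, v) * u * v\<^sup>2 + d (u, v) * v ^ 3"
    and D4: "has_D4_singularity k"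
  shows "a 0 * (4 * c 0 ^ 3 + 27 * a 0 * (d 0)\<^sup>2) \<noteq> 0"
proof
  assume disc: "a 0 * (4 * c 0 ^ 3 + 27 * a 0 * (d 0)\<^sup>2) = 0"
  \<comment> \<open>a multiple root of the cubic form; the last entry solves \<open>2 c u + 3 d v = 0\<close>\<close>
  define p :: "real \<times> real" where
    "p = (if a 0 = 0 then (1, 0) else if c 0 = 0 \<and> d 0 = 0 then (0, 1) else (3 * d 0, - 2 * c 0))"
  have "p \<noteq> 0" by (auto simp: p_def zero_prod_def)
  have disc': "4 * c 0 ^ 3 + 27 * a 0 * (d 0)\<^sup>2 = 0" if "a 0 \<noteq> 0" using disc that by simp
  have crit: "3 * a 0 * (fst p)\<^sup>2 + c 0 * (snd p)\<^sup>2 = 0"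
    "2 * c 0 * fst p * snd p + 3 * d 0 * (snd p)\<^sup>2 = 0"
    using disc' by (auto simp: p_def power2_eq_square power3_eq_cube algebra_simps)
  obtain e :: real where e: "e * e = 1" and "right_equivalent k (\<lambda>(u, v). u ^ 3 + e * (u * v\<^sup>2))"
    using D4 unfolding has_D4_singularity_def
    by (elim disjE) (auto intro: that[of 1] that[of "- 1"])
  then obtain U V \<theta> \<theta>' where UV: "open U" "0 \<in> U" "open V" "0 \<in> V" "homeomorphism U V \<theta> \<theta>'"
      "smooth_on U \<theta>" "smooth_on V \<theta>'" "\<theta> 0 = 0"
    and \<theta>: "\<And>p. p \<in> U \<Longrightarrow> fst p ^ 3 + e * (fst p * (snd p)\<^sup>2) = k (\<theta> p)"
    unfolding right_equivalent_def case_prod_unfold by blast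
  let ?T = "frechet_derivative \<theta> (at 0)" and ?T' = "frechet_derivative \<theta>' (at 0)"
  let ?N = "\<lambda>w :: real \<times> real. fst w ^ 3 + e * (fst w * (snd w)\<^sup>2)"
  have T: "(\<theta> has_derivative ?T) (at 0)" by (rule smooth_on_has_derivative[OF UV(6,2)])
  have "\<theta>' 0 = 0" using homeomorphism_apply1[OF UV(5,2)] UV(8) by simp
  then have "((\<lambda>q. \<theta> (\<theta>' q)) has_derivative (\<lambda>h. ?T (?T' h))) (at 0)"
    using T by (intro has_derivative_compose[OF smooth_on_has_derivative[OF UV(7,4)]]) simp
  then have "((\<lambda>q. q) has_derivative (\<lambda>h. ?T (?T' h))) (at 0)"
    by (rule has_derivative_transform_within_open[OF _ UV(3,4)])
      (rule homeomorphism_apply2[OF UV(5)])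
  then have TT': "?T (?T' h) = h" for h
    using has_derivative_unique[OF has_derivative_ident] by metis
  define w where "w = ?T' p"
  have Tw: "?T w = p" by (simp add: w_def TT')
  have N_eq: "?N w = a 0 * fst (?T w) ^ 3 + c 0 * fst (?T w) * (snd (?T w))\<^sup>2 + d 0 * snd (?T w) ^ 3"
    for w
    by (rule cubic_normal_form_tangent[OF assms(1-3) k UV(1,2) T UV(8)])
      (simp_all add: \<theta>[symmetric] algebra_simps power2_eq_square power3_eq_cube)
  have dT: "(?T has_derivative ?T) (at w)"
    by (rule bounded_linear_imp_has_derivative[OF has_derivative_bounded_linear[OF T]])
  note dT = has_derivative_fst[OF dT] has_derivative_snd[OF dT]
  have "((\<lambda>w. a 0 * fst (?T w) ^ 3 + c 0 * fst (?T w) * (snd (?T w))\<^sup>2 + d 0 * snd (?T w) ^ 3)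
      has_derivative (\<lambda>h. (3 * a 0 * (fst p)\<^sup>2 + c 0 * (snd p)\<^sup>2) * fst (?T h)
        + (2 * c 0 * fst p * snd p + 3 * d 0 * (snd p)\<^sup>2) * snd (?T h))) (at w)"
    by (rule derivative_eq_intros dT refl)+
      (simp add: Tw fun_eq_iff algebra_simps power2_eq_square)
  then have N0: "(?N has_derivative (\<lambda>h. 0)) (at w)" unfolding N_eq[symmetric] crit by simp
  have "(?N has_derivative (\<lambda>h. (3 * (fst w)\<^sup>2 + e * (snd w)\<^sup>2) * fst h
      + 2 * e * fst w * snd w * snd h)) (at w)"
    by (rule derivative_eq_intros refl)+ (simp add: fun_eq_iff algebra_simps power2_eq_square)
  from fun_cong[OF has_derivative_unique[OF this N0]]
  have *: "(3 * (fst w)\<^sup>2 + e * (snd w)\<^sup>2) * fst h + 2 * e * fst w * snd w * snd h = 0" for h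
    by simp
  have "3 * (fst w)\<^sup>2 + e * (snd w)\<^sup>2 = 0" "e * (fst w * snd w) = 0"
    using *[of "(1, 0)"] *[of "(0, 1)"] by auto
  then have "w = 0" using e by (auto simp: prod_eq_iff)
  then have "p = 0" using Tw linear_0[OF has_derivative_linear[OF T]] by simp
  with \<open>p \<noteq> 0\<close> show False by simp
qed

theorem has_D4_singularity_iff:
  fixes a c d k :: "real \<times> real \<Rightarrow> real"
  assumes "smooth_near 0 a" "smooth_near 0 c" "smooth_near 0 d"
    and k: "\<And>u v. k (u, v) = a (u, v) * u ^ 3 + c (u, v) * u * v\<^sup>2 + d (u, v) * v ^ 3"
  shows "has_D4_singularity k \<longleftrightarrow> a 0 \<noteq> 0 \<and> 4 * c 0 ^ 3 + 27 * a 0 * (d 0)\<^sup>2 \<noteq> 0"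
  using has_D4_singularityI[OF assms(1-3) _ _ k]
    has_D4_singularityD[OF assms(1-3)[THEN smooth_near_imp_isCont] k] by auto

section \<open>The axis extension and spatial vectors\<close>

text \<open>Every point of the axis is a limit of points off the axis, so a continuous function that agrees
with \<open>g\<close> off the axis provides the limit.\<close>

lemma axis_extension_eq:
  fixes g G :: "real \<times> real \<Rightarrow> 'b::t2_space"
  assumes U: "open U" "p \<in> U" and G: "continuous_on U G"
    and eq: "\<And>q. q \<in> U \<Longrightarrow> snd q \<noteq> 0 \<Longrightarrow> g q = G q"
  shows "axis_extension g p = G p"
proof (cases "snd p = 0")
  case True
  let ?F = "at p within {q. snd q \<noteq> 0}"
  have "p islimpt {q. snd q \<noteq> 0}"
    unfolding islimpt_approachable
  proof (intro allI impI)
    fix e :: real assume "e > 0"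
    then show "\<exists>q\<in>{q. snd q \<noteq> 0}. q \<noteq> p \<and> dist q p < e"
      using True by (intro bexI[of _ "(fst p, e / 2)"]) (auto simp: dist_prod_def prod_eq_iff)
  qed
  then have nt: "\<not> trivial_limit ?F" by (simp add: trivial_limit_within)
  have "(G \<longlongrightarrow> G p) ?F"
    using G U by (metis continuous_on_eq_continuous_at continuous_at_imp_continuous_at_within
        continuous_within)
  moreover have "\<forall>\<^sub>F q in ?F. q \<in> U" using U by (auto simp: eventually_at_topological)
  then have "\<forall>\<^sub>F q in ?F. G q = g q"
    using eq by (auto simp: eventually_at_filter elim: eventually_mono)
  ultimately have "(g \<longlongrightarrow> G p) ?F" by (rule Lim_transform_eventually)
  then have "Lim ?F g = G p" by (rule tendsto_Lim[OF nt])
  then show ?thesis using True by (simp add: axis_extension_def)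
qed (use eq U in \<open>simp add: axis_extension_def\<close>)

lemma has_derivative_locally_constant:
  assumes "open U" "x \<in> U" "(g has_derivative g') (at x)" "\<And>y. y \<in> U \<Longrightarrow> g y = c"
  shows "g' h = 0"
proof -
  have "((\<lambda>y. c) has_derivative g') (at x)"
    using has_derivative_transform_within_open[OF assms(3,1,2), of "\<lambda>y. c"] assms(4) by simp
  from has_derivative_unique[OF this has_derivative_const] show ?thesis by simp
qed

lemma frechet_derivative_cong_on_open:
  assumes "open U" "x \<in> U" "(g has_derivative g') (at x)" "\<And>y. y \<in> U \<Longrightarrow> f y = g y"
  shows "frechet_derivative f (at x) = g'"
proof -
  have "(f has_derivative g') (at x)"
    using has_derivative_transform_within_open[OF assms(3,1,2), of f] assms(4) by simp
  from frechet_derivative_at[OF this, symmetric] show ?thesis .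
qed

lemma bounded_bilinear_cross3: "bounded_bilinear cross3"
  by (rule bilinear_conv_bounded_bilinear[THEN iffD1, OF bilinear_cross])

lemma vector_3_eq_sum_axis:
  "(vector [x, y, z] :: real^3) = x *\<^sub>R axis 1 1 + y *\<^sub>R axis 2 1 + z *\<^sub>R axis 3 1"
  by (simp add: vec_eq_iff forall_3 axis_def)

lemma has_derivative_vector_3:
  fixes x y z :: "'a::real_normed_vector \<Rightarrow> real"
  assumes "(x has_derivative x') F" "(y has_derivative y') F" "(z has_derivative z') F"
  shows "((\<lambda>p. vector [x p, y p, z p] :: real^3) has_derivative (\<lambda>h. vector [x' h, y' h, z' h])) F"
  unfolding vector_3_eq_sum_axis
  by (intro has_derivative_add has_derivative_scaleR_left assms)

lemma smooth_on_vector_3: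
  fixes x y z :: "'a::real_normed_vector \<Rightarrow> real"
  assumes "smooth_on S x" "smooth_on S y" "smooth_on S z" "open S"
  shows "smooth_on S (\<lambda>p. vector [x p, y p, z p] :: real^3)"
  unfolding vector_3_eq_sum_axis by (intro smooth_intros assms)

lemma inner_real_3: "(x :: real^3) \<bullet> y = x $ 1 * y $ 1 + x $ 2 * y $ 2 + x $ 3 * y $ 3"
  by (simp add: inner_vec_def sum_3)

lemma smooth_on_has_real_derivative:
  assumes "smooth_on A g" "u \<in> A"
  shows "(g has_real_derivative frechet_derivative g (at u) 1) (at u)"
proof -
  have d: "(g has_derivative frechet_derivative g (at u)) (at u)"
    by (rule smooth_on_has_derivative[OF assms])
  have "frechet_derivative g (at u) h = frechet_derivative g (at u) 1 * h" for h
    using linear_scale[OF has_derivative_linear[OF d], of h 1] by simp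
  then have "frechet_derivative g (at u) = (*) (frechet_derivative g (at u) 1)" by blast
  then show ?thesis unfolding has_field_derivative_def by (rule has_derivative_eq_rhs[OF d])
qed

section \<open>Curvature of a cuspidal edge\<close>

text \<open>The normal form with its coefficients collected: \<open>P\<close> and \<open>Q\<close> depend on \<open>u\<close> only, which makes \<open>f\<^sub>v\<close>
divisible by \<open>v\<close>, and \<open>R 0 = 0\<close> makes the limiting tangent plane at \<open>0\<close> horizontal. Working with whole
functions \<open>P\<close>, \<open>Q\<close>, \<open>R\<close> keeps the remainder terms out of the curvature computation, where only
\<open>Q 0\<close>, \<open>Q' 0\<close> and the gradient of \<open>R\<close> at \<open>0\<close> survive.\<close>

locale cuspidal_edge =
  fixes P Q :: "real \<Rightarrow> real" and R :: "real \<times> real \<Rightarrow> real" and f :: "real \<times> real \<Rightarrow> real^3"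
    and A :: "real set" and U :: "(real \<times> real) set"
  assumes A: "open A" "smooth_on A P" "smooth_on A Q"
    and U: "open U" "0 \<in> U" "\<And>p. p \<in> U \<Longrightarrow> fst p \<in> A" and R: "smooth_on U R" "R 0 = 0"
    and f: "\<And>u v. f (u, v) = vector [u, u\<^sup>2 * P u + v\<^sup>2 / 2, u\<^sup>2 * Q u + v\<^sup>2 * R (u, v)]"
begin

abbreviation P' where "P' u \<equiv> frechet_derivative P (at u) 1"
abbreviation Q' where "Q' u \<equiv> frechet_derivative Q (at u) 1"
abbreviation Q'' where "Q'' u \<equiv> frechet_derivative Q' (at u) 1"
abbreviation R' where "R' p \<equiv> frechet_derivative R (at p)"

text \<open>Explicit versions of \<open>f\<^sub>u\<close>, \<open>\<psi>\<close> and \<open>\<nu>\<close>. They agree with the quantities defined by limits and by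
\<^const>\<open>frechet_derivative\<close> on \<open>U\<close>, and are visibly smooth there. The third component of \<open>\<psi>\<close> is \<open>s\<close>.\<close>

definition fu :: "real \<times> real \<Rightarrow> real^3" where
  "fu p = vector [1, 2 * fst p * P (fst p) + (fst p)\<^sup>2 * P' (fst p),
    2 * fst p * Q (fst p) + (fst p)\<^sup>2 * Q' (fst p) + (snd p)\<^sup>2 * R' p (1, 0)]"

definition s :: "real \<times> real \<Rightarrow> real" where
  "s p = 2 * R p + snd p * R' p (0, 1)"

definition \<psi> :: "real \<times> real \<Rightarrow> real^3" where
  "\<psi> p = vector [0, 1, s p]"

definition \<nu> :: "real \<times> real \<Rightarrow> real^3" where
  "\<nu> p = cross3 (fu p) (\<psi> p) /\<^sub>R norm (cross3 (fu p) (\<psi> p))"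

lemma smooth_on_fst_compose:
  assumes "smooth_on A g"
  shows "smooth_on U (\<lambda>p. g (fst p))"
  by (rule smooth_on_compose[OF smooth_on_fst[OF smooth_on_id] assms]) (use U in auto)

lemma has_derivative_fst_compose:
  assumes "smooth_on A g" "p \<in> U"
  shows "((\<lambda>p. g (fst p)) has_derivative (\<lambda>h. fst h * frechet_derivative g (at (fst p)) 1)) (at p)"
  by (rule DERIV_compose_FDERIV[OF smooth_on_has_real_derivative[OF assms(1) U(3)[OF assms(2)]]
        has_derivative_fst[OF has_derivative_ident]])

lemma f_has_derivative:
  assumes "p \<in> U"
  shows "(f has_derivative (\<lambda>h. fst h *\<^sub>R fu p + (snd h * snd p) *\<^sub>R \<psi> p)) (at p)"
proof -
  have f_eq: "f = (\<lambda>p. vector [fst p, (fst p)\<^sup>2 * P (fst p) + (snd p)\<^sup>2 / 2,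
      (fst p)\<^sup>2 * Q (fst p) + (snd p)\<^sup>2 * R p])"
    using f by (auto simp: fun_eq_iff)
  note PQ = has_derivative_fst_compose[OF A(2) assms] has_derivative_fst_compose[OF A(3) assms]
  have R': "(R has_derivative R' p) (at p)" by (rule smooth_on_has_derivative[OF R(1) assms])
  have lin: "R' p h = fst h * R' p (1, 0) + snd h * R' p (0, 1)" for h
  proof -
    have "R' p (fst h *\<^sub>R (1, 0) + snd h *\<^sub>R (0, 1)) = fst h * R' p (1, 0) + snd h * R' p (0, 1)"
      using has_derivative_linear[OF R'] by (simp only: linear_add linear_scale real_scaleR_def)
    then show ?thesis by simp
  qed
  have "(f has_derivative (\<lambda>h. vector [fst h,
      (2 * fst p * P (fst p) + (fst p)\<^sup>2 * P' (fst p)) * fst h + snd h * snd p,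
      (2 * fst p * Q (fst p) + (fst p)\<^sup>2 * Q' (fst p)) * fst h + 2 * snd p * R p * snd h
        + (snd p)\<^sup>2 * R' p h])) (at p)"
    unfolding f_eq
    by (rule has_derivative_vector_3; auto intro!: derivative_eq_intros PQ R' simp: algebra_simps)
  also have "(\<lambda>h. vector [fst h,
      (2 * fst p * P (fst p) + (fst p)\<^sup>2 * P' (fst p)) * fst h + snd h * snd p,
      (2 * fst p * Q (fst p) + (fst p)\<^sup>2 * Q' (fst p)) * fst h + 2 * snd p * R p * snd h
        + (snd p)\<^sup>2 * R' p h]) = (\<lambda>h. fst h *\<^sub>R fu p + (snd h * snd p) *\<^sub>R \<psi> p)"
    by (rule ext, subst lin)
      (simp add: vec_eq_iff forall_3 fu_def \<psi>_def s_def algebra_simps power2_eq_square)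
  finally show ?thesis .
qed

lemma D_u_f: "p \<in> U \<Longrightarrow> D_u f p = fu p" and D_v_f: "p \<in> U \<Longrightarrow> D_v f p = snd p *\<^sub>R \<psi> p"
  by (simp_all add: D_u_def D_v_def frechet_derivative_at[OF f_has_derivative, symmetric])

lemma smooth_s: "smooth_on U s"
  unfolding s_def by (intro smooth_intros smooth_on_frechet_derivative R U(1))

lemma smooth_\<psi>: "smooth_on U \<psi>"
  unfolding \<psi>_def by (intro smooth_on_vector_3 smooth_intros smooth_s U(1))

lemma smooth_fu: "smooth_on U fu"
  unfolding fu_def
  by (intro smooth_on_vector_3 smooth_intros smooth_on_fst_compose smooth_on_frechet_derivative
      A R U(1))

lemma psi_f: "p \<in> U \<Longrightarrow> psi f p = \<psi> p"
  unfolding psi_def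
  by (rule axis_extension_eq[OF U(1) _ smooth_on_imp_continuous_on[OF smooth_\<psi>]])
    (simp_all add: D_v_f)

lemma cross_nonzero: "cross3 (fu p) (\<psi> p) \<noteq> 0"
proof -
  have "cross3 (fu p) (\<psi> p) $ 3 = 1" by (simp add: cross3_def fu_def \<psi>_def)
  then show ?thesis by auto
qed

lemma unit_normal_f: "p \<in> U \<Longrightarrow> unit_normal f p = \<nu> p"
  by (simp add: unit_normal_def \<nu>_def D_u_f psi_f)

lemma smooth_\<nu>: "smooth_on U \<nu>"
  unfolding \<nu>_def
  by (intro smooth_on_scaleR smooth_on_inverse smooth_on_norm smooth_on_bounded_bilinear[OF _ _
        bounded_bilinear_cross3] smooth_fu smooth_\<psi> U(1)) (simp_all add: cross_nonzero)

lemma fu_inner_\<nu>: "fu p \<bullet> \<nu> p = 0" and \<psi>_inner_\<nu>: "\<psi> p \<bullet> \<nu> p = 0" and \<nu>_inner_\<nu>: "\<nu> p \<bullet> \<nu> p = 1"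
  using cross_nonzero[of p]
  by (simp_all add: \<nu>_def dot_cross_self dot_square_norm power2_eq_square)

lemma at_0: "fu 0 = vector [1, 0, 0]" "s 0 = 0" "\<psi> 0 = vector [0, 1, 0]" "\<nu> 0 = vector [0, 0, 1]"
proof -
  show fu: "fu 0 = vector [1, 0, 0]" and "s 0 = 0" by (simp_all add: fu_def s_def R)
  then show \<psi>: "\<psi> 0 = vector [0, 1, 0]" by (simp add: \<psi>_def)
  have "cross3 (fu 0) (\<psi> 0) = vector [0, 0, 1]"
    by (simp add: fu \<psi> cross3_def)
  moreover have "norm (vector [0, 0, 1] :: real^3) = 1"
    by (simp add: norm_eq_sqrt_inner inner_real_3)
  ultimately show "\<nu> 0 = vector [0, 0, 1]" by (simp add: \<nu>_def)
qed

abbreviation fu' where "fu' p \<equiv> frechet_derivative fu (at p)"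
abbreviation \<nu>' where "\<nu>' p \<equiv> frechet_derivative \<nu> (at p)"
abbreviation fuu where "fuu p \<equiv> fu' p (1, 0)"

lemma has_derivative_fu: "p \<in> U \<Longrightarrow> (fu has_derivative fu' p) (at p)"
  and has_derivative_\<nu>: "p \<in> U \<Longrightarrow> (\<nu> has_derivative \<nu>' p) (at p)"
  and has_derivative_s: "p \<in> U \<Longrightarrow> (s has_derivative frechet_derivative s (at p)) (at p)"
  and smooth_fuu: "smooth_on U fuu"
  by (rule smooth_on_has_derivative smooth_fu smooth_\<nu> smooth_s smooth_on_frechet_derivative
      | assumption)+

lemma fu'_nth_1:
  assumes "p \<in> U" shows "fu' p h $ 1 = 0"
  by (rule has_derivative_locally_constant[OF U(1) assms
        bounded_linear.has_derivative[OF bounded_linear_vec_nth has_derivative_fu[OF assms]], of 1 1])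
    (simp add: fu_def)

lemma fuu_nth_3:
  assumes p: "p \<in> U"
  shows "fuu p $ 3 = 2 * Q (fst p) + 4 * fst p * Q' (fst p) + (fst p)\<^sup>2 * Q'' (fst p)
    + (snd p)\<^sup>2 * frechet_derivative (\<lambda>p. R' p (1, 0)) (at p) (1, 0)"
proof -
  let ?Ru = "\<lambda>p. R' p (1, 0)"
  have Ru: "(?Ru has_derivative frechet_derivative ?Ru (at p)) (at p)"
    by (rule smooth_on_has_derivative[OF smooth_on_frechet_derivative[OF R(1)] p])
  note d = has_derivative_fst_compose[OF A(3) p]
    has_derivative_fst_compose[OF smooth_on_frechet_derivative[OF A(3)] p, of 1] Ru
  have "((\<lambda>p. 2 * fst p * Q (fst p) + (fst p)\<^sup>2 * Q' (fst p) + (snd p)\<^sup>2 * ?Ru p) has_derivative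
      (\<lambda>h. (2 * Q (fst p) + 4 * fst p * Q' (fst p) + (fst p)\<^sup>2 * Q'' (fst p)) * fst h
        + 2 * snd p * ?Ru p * snd h + (snd p)\<^sup>2 * frechet_derivative ?Ru (at p) h)) (at p)"
    by (auto intro!: derivative_eq_intros d simp: algebra_simps)
  moreover have "((\<lambda>p. fu p $ 3) has_derivative (\<lambda>h. fu' p h $ 3)) (at p)"
    by (rule bounded_linear.has_derivative[OF bounded_linear_vec_nth has_derivative_fu[OF p]])
  then have "((\<lambda>p. 2 * fst p * Q (fst p) + (fst p)\<^sup>2 * Q' (fst p) + (snd p)\<^sup>2 * ?Ru p) has_derivative
      (\<lambda>h. fu' p h $ 3)) (at p)"
    by (simp add: fu_def)
  ultimately have "(\<lambda>h. fu' p h $ 3) = (\<lambda>h. (2 * Q (fst p) + 4 * fst p * Q' (fst p) + (fst p)\<^sup>2 * Q'' (fst p)) * fst h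
        + 2 * snd p * ?Ru p * snd h + (snd p)\<^sup>2 * frechet_derivative ?Ru (at p) h)"
    using has_derivative_unique by blast
  from fun_cong[OF this, of "(1, 0)"] show ?thesis by simp
qed

lemma fuu'_nth_3: "frechet_derivative fuu (at 0) w $ 3 = 6 * Q' 0 * fst w"
proof -
  let ?Ruu = "\<lambda>p. frechet_derivative (\<lambda>p. R' p (1, 0)) (at p) (1, 0)"
  note smooth_Q' = smooth_on_frechet_derivative[OF A(3), of 1]
  have Ruu: "(?Ruu has_derivative frechet_derivative ?Ruu (at 0)) (at 0)"
    by (rule smooth_on_has_derivative[OF smooth_on_frechet_derivative[OF
            smooth_on_frechet_derivative[OF R(1)]] U(2)])
  note d = has_derivative_fst_compose[OF A(3) U(2)]
    has_derivative_fst_compose[OF smooth_Q' U(2)]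
    has_derivative_fst_compose[OF smooth_on_frechet_derivative[OF smooth_Q', of 1] U(2)] Ruu
  have "((\<lambda>p. 2 * Q (fst p) + 4 * fst p * Q' (fst p) + (fst p)\<^sup>2 * Q'' (fst p) + (snd p)\<^sup>2 * ?Ruu p)
      has_derivative (\<lambda>h. 6 * Q' 0 * fst h)) (at 0)"
    by (auto intro!: derivative_eq_intros d simp: algebra_simps)
  then have "((\<lambda>p. fuu p $ 3) has_derivative (\<lambda>h. 6 * Q' 0 * fst h)) (at 0)"
    by (rule has_derivative_transform_within_open[OF _ U(1,2)]) (simp only: fuu_nth_3)
  moreover have "((\<lambda>p. fuu p $ 3) has_derivative (\<lambda>h. frechet_derivative fuu (at 0) h $ 3)) (at 0)"
    by (rule bounded_linear.has_derivative[OF bounded_linear_vec_nth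
          smooth_on_has_derivative[OF smooth_fuu U(2)]])
  ultimately show ?thesis using has_derivative_unique by metis
qed

abbreviation s' where "s' \<equiv> frechet_derivative s (at 0)"

lemma s'_eq: "s' h = 2 * R' 0 h + snd h * R' 0 (0, 1)"
proof -
  let ?Rv = "\<lambda>p. R' p (0, 1)"
  have "(?Rv has_derivative frechet_derivative ?Rv (at 0)) (at 0)"
    by (rule smooth_on_has_derivative[OF smooth_on_frechet_derivative[OF R(1)] U(2)])
  then have "(s has_derivative (\<lambda>h. 2 * R' 0 h + snd h * R' 0 (0, 1))) (at 0)"
    unfolding s_def
    by (auto intro!: derivative_eq_intros smooth_on_has_derivative[OF R(1) U(2)])
  from frechet_derivative_at[OF this, symmetric] show ?thesis by simp
qed

text \<open>Differentiating \<open>\<psi> \<bullet> \<nu> = 0\<close> and \<open>\<nu> \<bullet> \<nu> = 1\<close> gives the needed components of \<open>d\<nu>\<close>, without a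
derivative of the normalising factor.\<close>

lemma \<nu>'_at_0: "\<nu>' 0 h $ 2 = - s' h" "\<nu>' 0 h $ 3 = 0"
proof -
  have "(\<psi> has_derivative (\<lambda>h. vector [0, 0, s' h])) (at 0)"
    unfolding \<psi>_def by (intro has_derivative_vector_3 has_derivative_const has_derivative_s U(2))
  from has_derivative_inner[OF this has_derivative_\<nu>[OF U(2)]]
  have "\<psi> 0 \<bullet> \<nu>' 0 h + vector [0, 0, s' h] \<bullet> \<nu> 0 = 0"
    by (rule has_derivative_locally_constant[OF U(1,2)]) (rule \<psi>_inner_\<nu>)
  then show "\<nu>' 0 h $ 2 = - s' h" by (simp add: at_0 inner_real_3)
  from has_derivative_inner[OF has_derivative_\<nu>[OF U(2)] has_derivative_\<nu>[OF U(2)]]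
  have "\<nu> 0 \<bullet> \<nu>' 0 h + \<nu>' 0 h \<bullet> \<nu> 0 = 0"
    by (rule has_derivative_locally_constant[OF U(1,2)]) (rule \<nu>_inner_\<nu>)
  then show "\<nu>' 0 h $ 3 = 0" by (simp add: at_0 inner_real_3)
qed

text \<open>\<open>L\<close> is written with \<open>f\<^sub>u\<^sub>u\<close> rather than \<open>\<nu>\<^sub>u\<close>: its derivative then needs only first derivatives of \<open>\<nu>\<close>.\<close>

definition E where "E p = fu p \<bullet> fu p"
definition F where "F p = fu p \<bullet> \<psi> p"
definition G where "G p = \<psi> p \<bullet> \<psi> p"
definition L where "L p = fuu p \<bullet> \<nu> p"
definition M where "M p = - (\<psi> p \<bullet> \<nu>' p (1, 0))"
definition N where "N p = - (\<psi> p \<bullet> \<nu>' p (0, 1))"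

lemma frechet_unit_normal_f:
  assumes "p \<in> U" shows "frechet_derivative (unit_normal f) (at p) = \<nu>' p"
  by (rule frechet_derivative_cong_on_open[OF U(1) assms has_derivative_\<nu>[OF assms]])
    (simp add: unit_normal_f)

lemma hats:
  assumes p: "p \<in> U"
  shows "E_hat f p = E p" "F_hat f p = F p" "G_hat f p = G p"
    "L_hat f p = L p" "M_hat f p = M p" "N_hat f p = N p"
proof -
  from has_derivative_locally_constant[OF U(1) p has_derivative_inner[OF has_derivative_fu[OF p]
        has_derivative_\<nu>[OF p]], of 0 "(1, 0)"]
  have "fu p \<bullet> \<nu>' p (1, 0) + fuu p \<bullet> \<nu> p = 0" by (simp add: fu_inner_\<nu>)
  then show "L_hat f p = L p"
    by (simp add: L_hat_def L_def D_u_f[OF p] D_u_def[of "unit_normal f"] frechet_unit_normal_f[OF p])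
qed (simp_all add: E_hat_def E_def F_hat_def F_def G_hat_def G_def M_hat_def M_def N_hat_def N_def
    D_u_f[OF p] psi_f[OF p] D_u_def[of "unit_normal f"] D_v_def[of "unit_normal f"]
    frechet_unit_normal_f[OF p])

lemma smooth_forms:
  "smooth_on U E" "smooth_on U F" "smooth_on U G" "smooth_on U L" "smooth_on U M" "smooth_on U N"
  unfolding E_def F_def G_def L_def M_def N_def
  by (intro smooth_intros smooth_fu smooth_\<psi> smooth_\<nu> smooth_on_frechet_derivative U(1))+

lemma forms_at_0: "E 0 = 1" "F 0 = 0" "G 0 = 1" "L 0 = 2 * Q 0" "M 0 = s' (1, 0)" "N 0 = s' (0, 1)"
  using fuu_nth_3[OF U(2)]
  by (simp_all add: E_def F_def G_def L_def M_def N_def at_0 inner_real_3 \<nu>'_at_0)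

lemma E'_at_0: "(E has_derivative (\<lambda>h. 0)) (at 0)"
proof -
  have "(E has_derivative (\<lambda>h. fu 0 \<bullet> fu' 0 h + fu' 0 h \<bullet> fu 0)) (at 0)"
    unfolding E_def by (rule has_derivative_inner[OF has_derivative_fu has_derivative_fu]) (rule U(2))+
  then show ?thesis by (simp add: at_0 inner_real_3 fu'_nth_1[OF U(2)])
qed

text \<open>The derivative of the normal enters only through \<open>s'\<close>, which vanishes on \<open>(N, - M)\<close>, so that no
coefficient of \<open>P\<close> appears in the ridge condition.\<close>

lemma L'_at_0: "(L has_derivative (\<lambda>h. 6 * Q' 0 * fst h - fuu 0 $ 2 * s' h)) (at 0)"
proof -
  have "(L has_derivative (\<lambda>h. fuu 0 \<bullet> \<nu>' 0 h + frechet_derivative fuu (at 0) h \<bullet> \<nu> 0)) (at 0)"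
    unfolding L_def
    by (rule has_derivative_inner[OF smooth_on_has_derivative[OF smooth_fuu] has_derivative_\<nu>])
      (rule U(2))+
  then show ?thesis
    by (elim has_derivative_eq_rhs)
      (simp add: at_0 inner_real_3 fu'_nth_1[OF U(2)] \<nu>'_at_0 fuu'_nth_3 fun_eq_iff)
qed

text \<open>\<open>H\<close> is the function called \<open>A_hat\<close>, and \<open>\<Delta>\<close> the expression under the root in \<open>B_hat\<close>. Expanding
\<open>(H - \<surd>\<Delta>) / (2 v W)\<close> by the conjugate \<open>H + \<surd>\<Delta>\<close> cancels the factor \<open>v\<close>, which gives \<open>\<kappa>\<close>.\<close>

definition W where "W p = E p * G p - (F p)\<^sup>2"
definition C where "C p = L p * N p - snd p * (M p)\<^sup>2"
definition H where "H p = E p * N p - 2 * snd p * F p * M p + snd p * G p * L p"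
definition \<Delta> where "\<Delta> p = (H p)\<^sup>2 - 4 * snd p * W p * C p"
definition \<kappa> where "\<kappa> p = 2 * C p / (H p + sqrt (\<Delta> p))"

lemma W_pos: "W p > 0"
proof -
  have "W p = (norm (cross3 (fu p) (\<psi> p)))\<^sup>2"
    by (simp add: W_def E_def F_def G_def norm_cross dot_square_norm)
  then show ?thesis using cross_nonzero[of p] by simp
qed

lemma smooth_WCH: "smooth_on U W" "smooth_on U C" "smooth_on U H" "smooth_on U \<Delta>"
proof -
  show W: "smooth_on U W" and C: "smooth_on U C" and H: "smooth_on U H"
    unfolding W_def C_def H_def by (intro smooth_intros smooth_forms U(1))+
  show "smooth_on U \<Delta>" unfolding \<Delta>_def by (intro smooth_intros W C H U(1))
qed

text \<open>At \<open>0\<close> both \<open>H\<close> and \<open>\<surd>\<Delta>\<close> equal \<open>N 0\<close>, so positivity of \<open>N 0\<close> keeps the denominator of \<open>\<kappa>\<close> positive and the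
root smooth near \<open>0\<close>.\<close>

lemma \<kappa>_neighbourhood:
  assumes "N 0 > 0"
  obtains V where "open V" "0 \<in> V" "V \<subseteq> U" "smooth_on V \<kappa>" "\<And>p. p \<in> V \<Longrightarrow> kappa2_hat f p = \<kappa> p"
    "\<And>p. p \<in> V \<Longrightarrow> snd p * W p * (\<kappa> p)\<^sup>2 - H p * \<kappa> p + C p = 0"
proof -
  have "H 0 > 0" "\<Delta> 0 > 0" using assms by (simp_all add: H_def \<Delta>_def forms_at_0(1))
  from continuous_on_positive_neighbourhood[OF smooth_on_imp_continuous_on[OF smooth_WCH(3)]
      U(1,2) this(1)]
  obtain V1 where V1: "open V1" "0 \<in> V1" "V1 \<subseteq> U" "\<And>p. p \<in> V1 \<Longrightarrow> H p > 0" by blast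
  from continuous_on_positive_neighbourhood[OF smooth_on_imp_continuous_on[OF smooth_on_subset[OF
          smooth_WCH(4) V1(3)]] V1(1,2) \<open>\<Delta> 0 > 0\<close>]
  obtain V where V: "open V" "0 \<in> V" "V \<subseteq> V1" "\<And>p. p \<in> V \<Longrightarrow> \<Delta> p > 0" by blast
  have VU: "V \<subseteq> U" using V1(3) V(3) by blast
  note smooth = smooth_WCH[THEN smooth_on_subset, OF VU]
  have denominator: "H p + sqrt (\<Delta> p) > 0" if "p \<in> V" for p
    using V1(4)[of p] V(3,4) that by (intro add_pos_pos) auto
  have "smooth_on V (\<lambda>p. H p + sqrt (\<Delta> p))" by (intro smooth_intros smooth V)
  then have \<kappa>: "smooth_on V \<kappa>" unfolding \<kappa>_def
    by (intro smooth_on_divide smooth_on_mult smooth_on_const smooth V(1))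
      (use denominator in fastforce)+
  have root: "snd p * W p * (\<kappa> p)\<^sup>2 - H p * \<kappa> p + C p = 0"
    and conjugate: "H p - sqrt (\<Delta> p) = 2 * snd p * W p * \<kappa> p" if p: "p \<in> V" for p
  proof -
    define r where "r = sqrt (\<Delta> p)"
    have r: "r\<^sup>2 = (H p)\<^sup>2 - 4 * snd p * W p * C p"
      using V(4)[OF p] by (simp add: r_def \<Delta>_def)
    have "\<kappa> p * (H p + r) = 2 * C p" "H p + r \<noteq> 0"
      using denominator[OF p] by (simp_all add: \<kappa>_def r_def)
    then have "(H p + r) * (H p - r - 2 * snd p * W p * \<kappa> p) = 0" using r by algebra
    then show *: "H p - sqrt (\<Delta> p) = 2 * snd p * W p * \<kappa> p"
      using \<open>H p + r \<noteq> 0\<close> by (simp add: r_def)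
    have "2 * (snd p * W p * (\<kappa> p)\<^sup>2 - H p * \<kappa> p + C p) = 0"
      using * \<open>\<kappa> p * (H p + r) = 2 * C p\<close> unfolding r_def[symmetric] by algebra
    then show "snd p * W p * (\<kappa> p)\<^sup>2 - H p * \<kappa> p + C p = 0" by simp
  qed
  have "kappa2_hat f p = \<kappa> p" if "p \<in> V" for p
    unfolding kappa2_hat_def
  proof (rule axis_extension_eq[OF V(1) that smooth_on_imp_continuous_on[OF \<kappa>]])
    fix q assume q: "q \<in> V" "snd q \<noteq> 0"
    then have hq: "E_hat f q = E q" "F_hat f q = F q" "G_hat f q = G q"
      "L_hat f q = L q" "M_hat f q = M q" "N_hat f q = N q"
      using hats[of q] VU by auto
    have A: "A_hat f q = H q" by (simp add: A_hat_def H_def hq)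
    have "B_hat f q = sqrt (\<Delta> q)" by (simp add: B_hat_def A \<Delta>_def W_def C_def hq)
    then have "(A_hat f q - B_hat f q) / (2 * snd q * (E_hat f q * G_hat f q - (F_hat f q)\<^sup>2))
        = 2 * snd q * W q * \<kappa> q / (2 * snd q * W q)"
      using conjugate[OF q(1)] by (simp add: A W_def hq)
    also have "\<dots> = \<kappa> q" using q(2) W_pos[of q] by simp
    finally show "(A_hat f q - B_hat f q) / (2 * snd q * (E_hat f q * G_hat f q - (F_hat f q)\<^sup>2))
        = \<kappa> q" .
  qed
  then show thesis using that[OF V(1,2) VU \<kappa>] root by blast
qed

lemma \<kappa>_at_0: "N 0 > 0 \<Longrightarrow> \<kappa> 0 = L 0"
  by (simp add: \<kappa>_def C_def H_def \<Delta>_def forms_at_0(1))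

text \<open>Differentiate the quadratic equation at \<open>0\<close>. The derivatives of \<open>F\<close>, \<open>G\<close>, \<open>M\<close> and \<open>W\<close> are multiplied by
zero, and those of \<open>N\<close> cancel because \<open>\<kappa> 0 = L 0\<close>.\<close>

lemma \<kappa>'_at_0:
  assumes N: "N 0 > 0" and \<kappa>': "(\<kappa> has_derivative \<kappa>') (at 0)"
    and V: "open V" "0 \<in> V" "\<And>p. p \<in> V \<Longrightarrow> snd p * W p * (\<kappa> p)\<^sup>2 - H p * \<kappa> p + C p = 0"
  shows "N 0 * \<kappa>' w = N 0 * (6 * Q' 0 * fst w - fuu 0 $ 2 * s' w) - snd w * (M 0)\<^sup>2"
proof -
  let ?L' = "\<lambda>w. 6 * Q' 0 * fst w - fuu 0 $ 2 * s' w"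
  obtain F' G' M' N' where d: "(F has_derivative F') (at 0)" "(G has_derivative G') (at 0)"
    "(M has_derivative M') (at 0)" "(N has_derivative N') (at 0)"
    using smooth_forms[THEN smooth_on_has_derivative, OF U(2)] by blast
  obtain W' where W': "(W has_derivative W') (at 0)"
    using smooth_WCH[THEN smooth_on_has_derivative, OF U(2)] by blast
  note d = d E'_at_0 L'_at_0
  have H': "(H has_derivative (\<lambda>w. N' w + snd w * L 0)) (at 0)"
    unfolding H_def by (auto intro!: derivative_eq_intros d simp: forms_at_0(1-3))
  have C': "(C has_derivative (\<lambda>w. ?L' w * N 0 + L 0 * N' w - snd w * (M 0)\<^sup>2)) (at 0)"
    unfolding C_def by (auto intro!: derivative_eq_intros d)
  have W0: "W 0 = 1" and H0: "H 0 = N 0" by (simp_all add: W_def H_def forms_at_0(1-3))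
  have "((\<lambda>p. snd p * W p * (\<kappa> p)\<^sup>2 - H p * \<kappa> p + C p) has_derivative
      (\<lambda>w. snd w * (L 0)\<^sup>2 - ((N' w + snd w * L 0) * L 0 + N 0 * \<kappa>' w)
        + (?L' w * N 0 + L 0 * N' w - snd w * (M 0)\<^sup>2))) (at 0)"
    by (rule derivative_eq_intros W' H' C' \<kappa>' refl)+
      (simp add: \<kappa>_at_0[OF N] W0 H0 fun_eq_iff algebra_simps power2_eq_square)
  from has_derivative_locally_constant[OF V(1,2) this V(3), of w] show ?thesis
    by (simp add: algebra_simps power2_eq_square)
qed

theorem kappa2_hat_at_0: "N_hat f 0 > 0 \<Longrightarrow> kappa2_hat f 0 = 2 * Q 0"
  using hats(6)[OF U(2)] \<kappa>_neighbourhood \<kappa>_at_0 forms_at_0(4) by metis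

theorem unit_normal_at_0: "unit_normal f 0 = vector [0, 0, 1]"
  by (simp add: unit_normal_f U at_0)

text \<open>Here \<open>N 0 = 3 R\<^sub>v\<close> and \<open>M 0 = 2 R\<^sub>u\<close> at \<open>0\<close>, so the condition is \<open>6 Q' N\<^sup>2 + M\<^sup>3 = 0\<close>.\<close>

theorem ridge_point_iff:
  assumes "N_hat f 0 > 0"
  shows "ridge_point f 0 \<longleftrightarrow> 54 * Q' 0 * (R' 0 (0, 1))\<^sup>2 + 8 * (R' 0 (1, 0)) ^ 3 = 0"
proof -
  have N: "N 0 > 0" using assms by (simp add: hats(6)[OF U(2)])
  obtain V where V: "open V" "0 \<in> V" "V \<subseteq> U" "smooth_on V \<kappa>" "\<And>p. p \<in> V \<Longrightarrow> kappa2_hat f p = \<kappa> p"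
    "\<And>p. p \<in> V \<Longrightarrow> snd p * W p * (\<kappa> p)\<^sup>2 - H p * \<kappa> p + C p = 0"
    using \<kappa>_neighbourhood[OF N] by blast
  let ?\<kappa>' = "frechet_derivative \<kappa> (at 0)" and ?w = "(N 0, - M 0)"
  have \<kappa>': "(\<kappa> has_derivative ?\<kappa>') (at 0)" by (rule smooth_on_has_derivative[OF V(4,2)])
  have "s' ?w = 0"
  proof -
    have "s' (N 0 *\<^sub>R (1, 0) - M 0 *\<^sub>R (0, 1)) = N 0 *\<^sub>R s' (1, 0) - M 0 *\<^sub>R s' (0, 1)"
      using has_derivative_linear[OF has_derivative_s[OF U(2)]]
      by (simp only: linear_diff linear_scale)
    then show ?thesis by (simp add: forms_at_0)
  qed
  with \<kappa>'_at_0[OF N \<kappa>' V(1,2,6), of ?w]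
  have eq: "N 0 * ?\<kappa>' ?w = 6 * Q' 0 * (N 0)\<^sup>2 + M 0 ^ 3"
    by (simp add: power2_eq_square power3_eq_cube algebra_simps)
  have "frechet_derivative (kappa2_hat f) (at 0) = ?\<kappa>'"
    by (rule frechet_derivative_cong_on_open[OF V(1,2) \<kappa>' V(5)])
  moreover have "principal_direction f 0 = ?w"
    by (simp add: principal_direction_def hats[OF U(2)] forms_at_0(2))
  ultimately have "ridge_point f 0 \<longleftrightarrow> ?\<kappa>' ?w = 0" by (simp add: ridge_point_def)
  also have "\<dots> \<longleftrightarrow> N 0 * ?\<kappa>' ?w = 0" using N by simp
  also have "\<dots> \<longleftrightarrow> 54 * Q' 0 * (R' 0 (0, 1))\<^sup>2 + 8 * (R' 0 (1, 0)) ^ 3 = 0"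
    unfolding eq by (simp add: forms_at_0 s'_eq power2_eq_square power3_eq_cube mult_ac)
  finally show ?thesis .
qed

end

section \<open>The distance-squared function at a cuspidal edge\<close>

theorem theorem3p3:
  fixes a20 a30 b20 b30 b12 b03 t0 :: real
    and h1 h2 h3 h4 :: "real \<Rightarrow> real" and h5 :: "real \<times> real \<Rightarrow> real"
    and h f :: "real \<times> real \<Rightarrow> real^3" and q :: "real^3"
    and \<phi> :: "real \<times> real \<Rightarrow> real"
  assumes "b20 \<ge> 0" and "b03 \<noteq> 0" and "b20 \<noteq> 0"
    and "smooth_near 0 h1" and "smooth_near 0 h2" and "smooth_near 0 h3" and "smooth_near 0 h4"
    and "smooth_near 0 h5"
    and h: "\<And>u v. h (u, v) = vector [0, u ^ 4 * h1 u,
              u ^ 4 * h2 u + u\<^sup>2 * v\<^sup>2 * h3 u + u * v ^ 3 * h4 u + v ^ 4 * h5 (u, v)]"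
    and f: "\<And>u v. f (u, v) = vector [u,
              a20 / 2 * u\<^sup>2 + a30 / 6 * u ^ 3 + v\<^sup>2 / 2,
              b20 / 2 * u\<^sup>2 + b30 / 6 * u ^ 3 + b12 / 2 * u * v\<^sup>2 + b03 / 6 * v ^ 3]
              + h (u, v)"
    and "\<forall>\<^sub>F u in nhds 0. N_hat f (u, 0) > 0"
    and t0: "t0 = 1 / kappa2_hat f 0"
    and q: "q = f 0 + t0 *\<^sub>R unit_normal f 0"
    and \<phi>: "\<And>p. \<phi> p = - (1 / 2) * ((norm (q - f p))\<^sup>2 - t0\<^sup>2)"
  shows "has_D4_singularity \<phi> \<longleftrightarrow> b30 \<noteq> 0 \<and> \<not> ridge_point f 0"
proof -
  obtain A where A: "open A" "0 \<in> A" "smooth_on A h1" "smooth_on A h2" "smooth_on A h3" "smooth_on A h4"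
  proof -
    obtain A1 A2 A3 A4 where "open A1" "0 \<in> A1" "smooth_on A1 h1" "open A2" "0 \<in> A2" "smooth_on A2 h2"
      "open A3" "0 \<in> A3" "smooth_on A3 h3" "open A4" "0 \<in> A4" "smooth_on A4 h4"
      using assms(4-7) unfolding smooth_near_def by metis
    then show thesis
      by (intro that[of "A1 \<inter> A2 \<inter> A3 \<inter> A4"]) (auto elim: smooth_on_subset)
  qed
  obtain B where B: "open B" "0 \<in> B" "smooth_on B h5" using assms(8) unfolding smooth_near_def by blast
  define U where "U = (A \<times> UNIV) \<inter> B"
  define P where "P u = a20 / 2 + a30 / 6 * u + u\<^sup>2 * h1 u" for u
  define Q where "Q u = b20 / 2 + b30 / 6 * u + u\<^sup>2 * h2 u" for u
  define R where "R p = b12 / 2 * fst p + b03 / 6 * snd p + (fst p)\<^sup>2 * h3 (fst p)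
    + fst p * snd p * h4 (fst p) + (snd p)\<^sup>2 * h5 p" for p
  have U: "open U" "0 \<in> U" "\<And>p. p \<in> U \<Longrightarrow> fst p \<in> A" "U \<subseteq> B"
    using A(1,2) B(1,2) by (auto simp: U_def open_Times zero_prod_def)
  have along_u: "smooth_on U (\<lambda>p. g (fst p))" if "smooth_on A g" for g :: "real \<Rightarrow> real"
    by (rule smooth_on_compose[OF smooth_on_fst[OF smooth_on_id] that]) (use U in auto)
  have h5: "smooth_on U h5" by (rule smooth_on_subset[OF B(3) U(4)])
  have P: "smooth_on A P" and Q: "smooth_on A Q"
    unfolding P_def Q_def
    by (intro smooth_on_add smooth_on_mult smooth_on_const smooth_on_id smooth_on_power A)+
  have R: "smooth_on U R"
    unfolding R_def by (intro smooth_on_add smooth_on_mult smooth_on_const smooth_on_id smooth_on_fst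
        smooth_on_snd smooth_on_power along_u A h5 U)
  have f_eq: "f (u, v) = vector [u, u\<^sup>2 * P u + v\<^sup>2 / 2, u\<^sup>2 * Q u + v\<^sup>2 * R (u, v)]" for u v
    unfolding f h P_def Q_def R_def
    by (simp add: vec_eq_iff forall_3 algebra_simps power2_eq_square power3_eq_cube power4_eq_xxxx)
  interpret edge: cuspidal_edge P Q R f A U
    by unfold_locales (use A(1) P Q U R f_eq in \<open>simp_all add: R_def\<close>)
  have "N_hat f (0, 0) > 0" using assms(11) by (rule eventually_nhds_x_imp_x)
  then have N: "N_hat f 0 > 0" by (simp add: zero_prod_def)
  have Q'0: "frechet_derivative Q (at 0) 1 = b30 / 6"
  proof -
    have "(Q has_derivative (\<lambda>h. b30 / 6 * h)) (at 0)"
      unfolding Q_def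
      by (auto intro!: derivative_eq_intros smooth_on_has_derivative[OF A(4,2)])
    from frechet_derivative_at[OF this, symmetric] show ?thesis by simp
  qed
  have R'0: "frechet_derivative R (at 0) w = b12 / 2 * fst w + b03 / 6 * snd w" for w
  proof -
    note d = edge.has_derivative_fst_compose[OF A(5) U(2)] edge.has_derivative_fst_compose[OF A(6) U(2)]
      smooth_on_has_derivative[OF h5 U(2)]
    have "(R has_derivative (\<lambda>w. b12 / 2 * fst w + b03 / 6 * snd w)) (at 0)"
      unfolding R_def by (auto intro!: derivative_eq_intros d)
    from frechet_derivative_at[OF this, symmetric] show ?thesis by simp
  qed
  have ridge: "ridge_point f 0 \<longleftrightarrow> 4 * b12 ^ 3 + b30 * b03\<^sup>2 = 0"
  proof -
    have "54 * frechet_derivative Q (at 0) 1 * (frechet_derivative R (at 0) (0, 1))\<^sup>2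
        + 8 * (frechet_derivative R (at 0) (1, 0)) ^ 3 = (4 * b12 ^ 3 + b30 * b03\<^sup>2) / 4"
      by (simp add: Q'0 R'0 field_simps power2_eq_square power3_eq_cube)
    then show ?thesis unfolding edge.ridge_point_iff[OF N] by (simp only:) simp
  qed
  have t0_eq: "t0 = 1 / b20" using t0 edge.kappa2_hat_at_0[OF N] by (simp add: Q_def)
  then have t0_nz: "t0 \<noteq> 0" and t0_b20: "t0 * b20 = 1" using \<open>b20 \<noteq> 0\<close> by simp_all
  have "f 0 = 0" using f_eq[of 0 0] by (simp add: zero_prod_def vec_eq_iff forall_3)
  then have q_eq: "q = vector [0, 0, t0]"
    by (simp add: q edge.unit_normal_at_0 vec_eq_iff forall_3)
  \<comment> \<open>the coefficients of \<open>u\<^sup>3\<close>, \<open>u v\<^sup>2\<close>, \<open>v\<^sup>3\<close>; terms divisible by \<open>u\<^sup>2 v\<^sup>2\<close> are put into \<open>c\<close>\<close>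
  define a where "a p = t0 * (b30 / 6 + fst p * h2 (fst p))
    - fst p * ((P (fst p))\<^sup>2 + (Q (fst p))\<^sup>2) * (1 / 2)" for p :: "real \<times> real"
  define c where "c p = t0 * (b12 / 2 + fst p * h3 (fst p) + snd p * h4 (fst p))
    - fst p * (P (fst p) * (1 / 2) + Q (fst p) * R p)" for p
  define d where "d p = t0 * (b03 / 6 + snd p * h5 p) - snd p * (1 / 8 + (R p)\<^sup>2 * (1 / 2))" for p
  have \<phi>_eq: "\<phi> (u, v) = a (u, v) * u ^ 3 + c (u, v) * u * v\<^sup>2 + d (u, v) * v ^ 3" for u v
  proof -
    have "\<phi> (u, v) = t0 * (u\<^sup>2 * Q u + v\<^sup>2 * R (u, v))
        - (u\<^sup>2 + (u\<^sup>2 * P u + v\<^sup>2 / 2)\<^sup>2 + (u\<^sup>2 * Q u + v\<^sup>2 * R (u, v))\<^sup>2) / 2"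
      unfolding \<phi> q_eq f_eq power2_norm_eq_inner inner_real_3
      by (simp add: field_simps power2_eq_square)
    moreover have "t0 * (u\<^sup>2 * Q u) = u\<^sup>2 / 2 + u ^ 3 * (t0 * (b30 / 6 + u * h2 u))"
      using t0_b20 unfolding Q_def by algebra
    moreover have "t0 * (v\<^sup>2 * R (u, v)) = u * v\<^sup>2 * (t0 * (b12 / 2 + u * h3 u + v * h4 u))
        + v ^ 3 * (t0 * (b03 / 6 + v * h5 (u, v)))"
      unfolding R_def fst_conv snd_conv by algebra
    ultimately show ?thesis
      unfolding a_def c_def d_def fst_conv snd_conv
      by (simp add: field_simps power2_eq_square power3_eq_cube)
  qed
  have "smooth_on U a" "smooth_on U c" "smooth_on U d"
    unfolding a_def c_def d_def
    by (intro smooth_on_diff smooth_on_add smooth_on_mult smooth_on_const smooth_on_id smooth_on_fst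
        smooth_on_snd smooth_on_power along_u A P Q R h5 U)+
  then have "smooth_near 0 a" "smooth_near 0 c" "smooth_near 0 d"
    using U(1,2) unfolding smooth_near_def by blast+
  note D4 = has_D4_singularity_iff[OF this \<phi>_eq]
  have a0: "a 0 = t0 * b30 / 6" and c0: "c 0 = t0 * b12 / 2" and d0: "d 0 = t0 * b03 / 6"
    by (simp_all add: a_def c_def d_def)
  have disc: "4 * c 0 ^ 3 + 27 * a 0 * (d 0)\<^sup>2 = t0 ^ 3 / 8 * (4 * b12 ^ 3 + b30 * b03\<^sup>2)"
    unfolding a0 c0 d0 by (simp add: field_simps power2_eq_square power3_eq_cube)
  have "a 0 \<noteq> 0 \<longleftrightarrow> b30 \<noteq> 0" using t0_nz by (simp add: a0)
  moreover have "4 * c 0 ^ 3 + 27 * a 0 * (d 0)\<^sup>2 \<noteq> 0 \<longleftrightarrow> 4 * b12 ^ 3 + b30 * b03\<^sup>2 \<noteq> 0"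
    unfolding disc using t0_nz by simp
  ultimately show ?thesis using D4 ridge by blast
qed

end
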